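(* Let $R$ be a complex rational function of degree $n\geq 2$ not conjugate (by a Möbius transformation) to $z^{n}$ or $z^{-n}$, and let $\Gamma$ be a subgroup of $G(R)$ such that $\gamma_R(\Gamma)\subseteq\Gamma$. Then every subsemigroup of $S_{\Gamma,R}$ is right amenable. On the other hand, $S_{\Gamma,R}$ is left amenable if and only if $\gamma_R(\Gamma)=\Gamma$. Moreover, in the last case (that is, if $\gamma_R(\Gamma)=\Gamma$) every subsemigroup of $S_{\Gamma,R}$ is amenable.
   Context: For a rational function $R\in\mathbb{C}(z)$ of degree at least two, $G(R)$ is the group of all Möbius transformations $\sigma$ such that $R\circ\sigma=\nu\circ R$ for some Möbius transformation $\nu$; this $\nu=\nu_\sigma$ is unique and $\gamma_R:\sigma\mapsto\nu_\sigma$ is a homomorphism from $G(R)$ to $\mathrm{Aut}(\mathbb{CP}^1)$. For a subgroup $\Gamma$ of $G(R)$ with $\gamma_R(\Gamma)\subseteq\Gamma$, $S_{\Gamma,R}$ is the semigroup generated under composition by $\Gamma$ and $R$. Semigroups and subsemigroups are nonempty. A semigroup $S$ is left amenable if there is a finitely additive probability measure $\mu$ defined on all subsets of $S$ such that $\mu(a^{-1}T)=\mu(T)$ for all $a\in S$, $T\subseteq S$, where $a^{-1}T=\{s\in S: as\in T\}$. Right amenable is defined symmetrically, with $\{s\in S: sa\in T\}$ in place of $a^{-1}T$. $S$ is amenable if it is both left and right amenable. *)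

theory Defs
  imports
    "HOL-Analysis.Analysis"
    "HOL-Algebra.Group"
    "HOL-Computational_Algebra.Computational_Algebra"
begin

section \<open>Rational functions on the Riemann sphere\<close>

text \<open>The Riemann sphere is the type of complex numbers with one extra point None at infinity.\<close>

type_synonym riemann_sphere = "complex option"

text \<open>
  The self-map of the sphere induced by the quotient p / q. The definition is meaningful for
  coprime p, q with q nonzero; the value at infinity is then the quotient of the leading
  coefficients if both degrees agree, and 0 if the degree of p is the smaller one.
\<close>

definition rat_map :: "complex poly \<Rightarrow> complex poly \<Rightarrow> riemann_sphere \<Rightarrow> riemann_sphere" where
  "rat_map p q w = (case w of
      Some z \<Rightarrow> if poly q z = 0 then None else Some (poly p z / poly q z)
    | None \<Rightarrow> if degree p > degree q then None
              else Some (coeff p (degree q) / lead_coeff q))"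

definition rational_of_degree :: "nat \<Rightarrow> (riemann_sphere \<Rightarrow> riemann_sphere) \<Rightarrow> bool" where
  "rational_of_degree n R \<longleftrightarrow>
    (\<exists>p q. q \<noteq> 0 \<and> coprime p q \<and> n = max (degree p) (degree q) \<and> R = rat_map p q)"

text \<open>The maps z \<mapsto> (a z + b) / (c z + d); polynomial coefficients are listed in ascending order.\<close>

definition moebius :: "(riemann_sphere \<Rightarrow> riemann_sphere) set" where
  "moebius = {rat_map [:b, a:] [:d, c:] | a b c d. a * d - b * c \<noteq> 0}"

definition moebius_conjugate ::
  "(riemann_sphere \<Rightarrow> riemann_sphere) \<Rightarrow> (riemann_sphere \<Rightarrow> riemann_sphere) \<Rightarrow> bool" where
  "moebius_conjugate f g \<longleftrightarrow> (\<exists>\<sigma>\<in>moebius. f = inv_into UNIV \<sigma> \<circ> g \<circ> \<sigma>)"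

definition pow_map :: "nat \<Rightarrow> riemann_sphere \<Rightarrow> riemann_sphere" where
  "pow_map n = rat_map (monom 1 n) 1"

definition neg_pow_map :: "nat \<Rightarrow> riemann_sphere \<Rightarrow> riemann_sphere" where
  "neg_pow_map n = rat_map 1 (monom 1 n)"


section \<open>The group G(R) and the homomorphism gamma\<close>

definition symmetry_group ::
  "(riemann_sphere \<Rightarrow> riemann_sphere) \<Rightarrow> (riemann_sphere \<Rightarrow> riemann_sphere) monoid" where
  "symmetry_group R =
    \<lparr>carrier = {\<sigma> \<in> moebius. \<exists>\<nu>\<in>moebius. R \<circ> \<sigma> = \<nu> \<circ> R}, mult = (\<circ>), one = id\<rparr>"

definition gamma ::
  "(riemann_sphere \<Rightarrow> riemann_sphere) \<Rightarrow> (riemann_sphere \<Rightarrow> riemann_sphere)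
    \<Rightarrow> riemann_sphere \<Rightarrow> riemann_sphere" where
  "gamma R \<sigma> = (THE \<nu>. \<nu> \<in> moebius \<and> R \<circ> \<sigma> = \<nu> \<circ> R)"


section \<open>Semigroups and amenability\<close>

inductive_set generated_semigroup :: "('a \<Rightarrow> 'a \<Rightarrow> 'a) \<Rightarrow> 'a set \<Rightarrow> 'a set"
  for f :: "'a \<Rightarrow> 'a \<Rightarrow> 'a" and A :: "'a set" where
  generator: "a \<in> A \<Longrightarrow> a \<in> generated_semigroup f A"
| product: "a \<in> generated_semigroup f A \<Longrightarrow> b \<in> generated_semigroup f A
    \<Longrightarrow> f a b \<in> generated_semigroup f A"

definition subsemigroup :: "('a \<Rightarrow> 'a \<Rightarrow> 'a) \<Rightarrow> 'a set \<Rightarrow> 'a set \<Rightarrow> bool" where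
  "subsemigroup f T S \<longleftrightarrow> T \<noteq> {} \<and> T \<subseteq> S \<and> (\<forall>a\<in>T. \<forall>b\<in>T. f a b \<in> T)"

definition finitely_additive_probability :: "'a set \<Rightarrow> ('a set \<Rightarrow> real) \<Rightarrow> bool" where
  "finitely_additive_probability S \<mu> \<longleftrightarrow>
    (\<forall>T\<subseteq>S. 0 \<le> \<mu> T) \<and> \<mu> S = 1 \<and> Measure_Space.additive (Pow S) \<mu>"

definition left_amenable :: "('a \<Rightarrow> 'a \<Rightarrow> 'a) \<Rightarrow> 'a set \<Rightarrow> bool" where
  "left_amenable f S \<longleftrightarrow>
    (\<exists>\<mu>. finitely_additive_probability S \<mu> \<and>
      (\<forall>a\<in>S. \<forall>T\<subseteq>S. \<mu> {s \<in> S. f a s \<in> T} = \<mu> T))"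

definition right_amenable :: "('a \<Rightarrow> 'a \<Rightarrow> 'a) \<Rightarrow> 'a set \<Rightarrow> bool" where
  "right_amenable f S \<longleftrightarrow>
    (\<exists>\<mu>. finitely_additive_probability S \<mu> \<and>
      (\<forall>a\<in>S. \<forall>T\<subseteq>S. \<mu> {s \<in> S. f s a \<in> T} = \<mu> T))"

definition amenable :: "('a \<Rightarrow> 'a \<Rightarrow> 'a) \<Rightarrow> 'a set \<Rightarrow> bool" where
  "amenable f S \<longleftrightarrow> left_amenable f S \<and> right_amenable f S"


section \<open>Well-definedness\<close>

text \<open>
  G(R) is a group, and for nonconstant R a Moebius transformation \<nu> with
  R \<circ> \<sigma> = \<nu> \<circ> R is unique, so the definite description in gamma is justified on G(R).
\<close>

lemma surj_rat_map:
  assumes "q \<noteq> 0" "coprime p q" "max (degree p) (degree q) \<ge> 1"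
  shows "surj (rat_map p q)"
proof -
  have nr: "\<not> (poly p z = 0 \<and> poly q z = 0)" for z
    using assms(2) coprime_poly_0 by blast
  have "\<exists>x. rat_map p q x = w" for w
  proof (cases w)
    case None
    show ?thesis
    proof (cases "degree q = 0")
      case True
      then have "degree p > degree q" using assms by auto
      then have "rat_map p q None = w" using None by (simp add: rat_map_def)
      then show ?thesis by blast
    next
      case False
      then obtain z where "poly q z = 0" 
        using fundamental_theorem_of_algebra[of q] by (auto simp: constant_degree)
      then have "rat_map p q (Some z) = w" using None by (simp add: rat_map_def)
      then show ?thesis by blast
    qed
  next
    case (Some c)
    let ?h = "p - smult c q"
    show ?thesis
    proof (cases "\<exists>z. poly ?h z = 0")
      case True
      then obtain z where z: "poly p z = c * poly q z" by auto
      with nr[of z] have "poly q z \<noteq> 0" by auto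
      with z have "rat_map p q (Some z) = w" using Some by (simp add: rat_map_def)
      then show ?thesis by blast
    next
      case False
      then have "degree ?h = 0" 
        using fundamental_theorem_of_algebra[of ?h] by (auto simp: constant_degree simp del: poly_diff)
      then obtain e where e: "?h = [:e:]" by (rule degree_eq_zeroE)
      then have p: "p = smult c q + [:e:]" by (simp add: algebra_simps)
      have dp: "degree p \<le> degree q" unfolding p by (intro degree_add_le) auto
      then have "degree q \<ge> 1" using assms by auto
      then have "coeff p (degree q) = c * lead_coeff q" unfolding p
        by (cases "degree q") auto
      then have "rat_map p q None = w" using Some dp assms by (simp add: rat_map_def)
      then show ?thesis by blast
    qed
  qed
  then show ?thesis unfolding surj_def by metis
qed

lemma moebius_factor_unique:
  assumes "rational_of_degree n R" "n \<ge> 1" and "\<nu> \<circ> R = \<nu>' \<circ> R"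
  shows "\<nu> = \<nu>'"
proof
  fix w
  have "surj R" using assms surj_rat_map unfolding rational_of_degree_def by auto
  then obtain x where "w = R x" by (rule surjE)
  then show "\<nu> w = \<nu>' w" using fun_cong[OF assms(3), of x] by simp
qed

lemma moebius_eval:
  "ad - b*c \<noteq> (0::complex) \<Longrightarrow> ad = a*d \<Longrightarrow> rat_map [:b, a:] [:d, c:] w = (case w of
     Some z \<Rightarrow> if c*z+d = 0 then None else Some ((a*z+b)/(c*z+d))
   | None \<Rightarrow> if c = 0 then None else Some (a/c))"
  by (cases w) (auto simp: rat_map_def algebra_simps)

lemma rat_map_moebius_comp:
  assumes "a*d - b*c \<noteq> 0" "a'*d' - b'*c' \<noteq> 0"
  shows "rat_map [:b, a:] [:d, c:] \<circ> rat_map [:b', a':] [:d', c':] =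
    rat_map [:a*b'+b*d', a*a'+b*c':] [:c*b'+d*d', c*a'+d*c':]"
proof 
  fix w
  have D: "(a*a'+b*c')*(c*b'+d*d') - (a*b'+b*d')*(c*a'+d*c') \<noteq> 0"
  proof -
    have "(a*a'+b*c')*(c*b'+d*d') - (a*b'+b*d')*(c*a'+d*c') = (a*d-b*c)*(a'*d'-b'*c')"
      by algebra
    then show ?thesis using assms by simp
  qed
  show "(rat_map [:b, a:] [:d, c:] \<circ> rat_map [:b', a':] [:d', c':]) w =
    rat_map [:a*b'+b*d', a*a'+b*c':] [:c*b'+d*d', c*a'+d*c':] w"
  proof (cases w)
    case None
    show ?thesis
    proof (cases "c' = 0")
      case True
      then have "a' \<noteq> 0" using assms by auto
      then show ?thesis using None True
        unfolding o_def moebius_eval[OF D refl] moebius_eval[OF assms(1) refl] moebius_eval[OF assms(2) refl] by simp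
    next
      case False
      have "c * (a'/c') + d = (c*a'+d*c')/c'" "a * (a'/c') + b = (a*a'+b*c')/c'"
        using False by (auto simp: field_simps)
      then show ?thesis using None False
        unfolding o_def moebius_eval[OF D refl] moebius_eval[OF assms(1) refl] moebius_eval[OF assms(2) refl] by simp
    qed
  next
    case (Some z)
    have e1: "(c*a'+d*c')*z + (c*b'+d*d') = c*(a'*z+b') + d*(c'*z+d')"
     "(a*a'+b*c')*z + (a*b'+b*d') = a*(a'*z+b') + b*(c'*z+d')" by algebra+
    have lin: "u * (X / Y) + v = (u * X + v * Y) / Y" if "Y \<noteq> 0" for u v X Y :: complex
      using that by (simp add: add_divide_distrib)
    show ?thesis
    proof (cases "c'*z+d' = 0")
      case True
      have "a'*z+b' \<noteq> 0" 
      proof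
        assume "a'*z+b' = 0"
        then have "a'*d' - b'*c' = 0" using True by algebra
        then show False using assms by simp
      qed
      then show ?thesis using Some True
        unfolding o_def moebius_eval[OF D refl] moebius_eval[OF assms(1) refl] moebius_eval[OF assms(2) refl] by (simp add: e1)
    next
      case False
      have "c * ((a'*z+b')/(c'*z+d')) + d = (c*(a'*z+b') + d*(c'*z+d'))/(c'*z+d')" 
           "a * ((a'*z+b')/(c'*z+d')) + b = (a*(a'*z+b') + b*(c'*z+d'))/(c'*z+d')"
        using lin[OF False] by blast+
      then show ?thesis using Some False
        unfolding o_def moebius_eval[OF D refl] moebius_eval[OF assms(1) refl] moebius_eval[OF assms(2) refl] by (simp add: e1)
    qed
  qed
qed

lemma moebius_comp: "f \<in> moebius \<Longrightarrow> g \<in> moebius \<Longrightarrow> f \<circ> g \<in> moebius"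
proof -
  assume "f \<in> moebius" "g \<in> moebius"
  then obtain a b c d a' b' c' d' where *: "f = rat_map [:b, a:] [:d, c:]" "g = rat_map [:b', a':] [:d', c':]"
    "a*d - b*c \<noteq> 0" "a'*d' - b'*c' \<noteq> 0" unfolding moebius_def by blast
  have "(a*a'+b*c')*(c*b'+d*d') - (a*b'+b*d')*(c*a'+d*c') = (a*d-b*c)*(a'*d'-b'*c')"
      by algebra
  then have "(a*a'+b*c')*(c*b'+d*d') - (a*b'+b*d')*(c*a'+d*c') \<noteq> 0" using * by simp
  then show ?thesis unfolding moebius_def using rat_map_moebius_comp[OF *(3,4)] * by blast
qed

lemma rat_map_scalar_id: "k \<noteq> 0 \<Longrightarrow> rat_map [:0,k:] [:k,0:] = id"
  by (rule ext) (auto simp: rat_map_def split: option.split)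

lemma moebius_id: "id \<in> moebius"
proof -
  have "rat_map [:0, 1:] [:1, 0:] \<in> moebius"
    unfolding moebius_def by (rule CollectI, rule exI[of _ 1], rule exI[of _ 0],
        rule exI[of _ 0], rule exI[of _ 1]) simp
  then show ?thesis using rat_map_scalar_id[of 1] by simp
qed

lemma moebius_inv: "f \<in> moebius \<Longrightarrow> \<exists>g\<in>moebius. f \<circ> g = id \<and> g \<circ> f = id"
proof -
  assume "f \<in> moebius" 
  then obtain a b c d where *: "f = rat_map [:b, a:] [:d, c:]"
    "a*d - b*c \<noteq> 0" unfolding moebius_def by blast
  let ?g = "rat_map [:-b, d:] [:a, -c:]"
  have D: "d*a - (-b)*(-c) \<noteq> 0" using * by (simp add: algebra_simps)
  have z: "a*(-b)+b*a = 0" "c*d+d*(-c) = 0" "d*b+(-b)*d = 0" "(-c)*a+a*c = 0" by algebra+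
  have e: "a*d+b*(-c) = a*d-b*c" "c*(-b)+d*a = a*d-b*c" "d*a+(-b)*c = a*d-b*c" "(-c)*b+a*d=a*d-b*c" by algebra+
  have "f \<circ> ?g = id" unfolding *(1) rat_map_moebius_comp[OF *(2) D] z e by (rule rat_map_scalar_id[OF *(2)])
  moreover have "?g \<circ> f = id" unfolding *(1) rat_map_moebius_comp[OF D *(2)] z e by (rule rat_map_scalar_id[OF *(2)])
  moreover have "?g \<in> moebius" unfolding moebius_def using D by blast
  ultimately show ?thesis by blast
qed

lemma group_symmetry_group: "group (symmetry_group R)"
proof (rule groupI)
  fix x y assume "x \<in> carrier (symmetry_group R)" "y \<in> carrier (symmetry_group R)"
  then obtain v u where "x \<in> moebius" "y \<in> moebius" "v \<in> moebius" "u \<in> moebius" 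
    "R \<circ> x = v \<circ> R" "R \<circ> y = u \<circ> R" by (auto simp: symmetry_group_def)
  then show "x \<otimes>\<^bsub>symmetry_group R\<^esub> y \<in> carrier (symmetry_group R)"
    using moebius_comp by (auto simp: symmetry_group_def) (metis comp_assoc)
next
  fix x assume "x \<in> carrier (symmetry_group R)"
  then obtain v where 1: "x \<in> moebius" "v \<in> moebius" "R \<circ> x = v \<circ> R" by (auto simp: symmetry_group_def)
  then obtain y w where 2: "y \<in> moebius" "w \<in> moebius" "x \<circ> y = id" "y \<circ> x = id" "w \<circ> v = id" "v \<circ> w = id"
    using moebius_inv by meson
  have "R \<circ> y = w \<circ> v \<circ> R \<circ> y" using 2 by simp
  also have "\<dots> = w \<circ> (R \<circ> x) \<circ> y" using 1 by (simp add: comp_assoc)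
  also have "\<dots> = w \<circ> R" using 2 by (simp add: comp_assoc)
  finally show "\<exists>y\<in>carrier (symmetry_group R). y \<otimes>\<^bsub>symmetry_group R\<^esub> x = \<one>\<^bsub>symmetry_group R\<^esub>"
    using 2 by (auto simp: symmetry_group_def)
qed (use moebius_id in \<open>auto simp: symmetry_group_def comp_assoc intro!: bexI[of _ id]\<close>)

end

(*
  Every element of the semigroup is sigma o R^k for a unique sigma in Gamma and k (unique because
  R is surjective and not injective), so k is additive and its level sets have at most |Gamma|
  elements. If Gamma is finite, the elements of level at most N therefore form a Foelner sequence
  in every subsemigroup for each side on which translations are injective. Right translations
  always are; left translations are if gamma_R is injective on Gamma, which for finite Gamma
  amounts to gamma_R(Gamma) = Gamma.

  Gamma is finite: it permutes the finite set E of points in fibres with fewer than n elements,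
  and gamma_R(Gamma) also permutes R(E). Unless gamma_R(Gamma), and with it Gamma, is finite,
  E together with R(E) has at most two points; counting zeros of the Wronskian then gives
  R = M1 o z^n o M2, and E = R(E) makes R conjugate to z^n or z^(-n).
*)
theory Submission
  imports Defs
begin

text \<open>Amenability does not in general pass to subsemigroups, so it is not enough to find an
  invariant measure on the whole semigroup. The Foelner argument is run inside each subsemigroup
  instead: it needs only a uniform upper bound for the level sets and injective translations, and
  both are inherited. A subsemigroup may have empty levels, so no lower bound for single levels is
  at hand; growth comes from the powers of one element of positive level, while translation by an
  element of level 0 has no boundary term at all.

  The necessity of gamma_R(Gamma) = Gamma needs a different argument: an element of Gamma that
  gamma_R misses produces two disjoint right ideals, each of full measure for any left-invariant
  mean.\<close>

section \<open>Graded semigroups with injective translations are amenable\<close>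

text \<open>Tychonoff, transferred to the function type, whose topology is the product
  topology.\<close>

lemma compact_cube: "compact {g :: 'a \<Rightarrow> real. \<forall>x. g x \<in> {0..1}}"
proof -
  have "compactin (product_topology (\<lambda>i::'a. euclidean :: real topology) UNIV) (PiE UNIV (\<lambda>i. {0..1}))"
    by (subst compactin_PiE) simp
  then have "compactin euclidean (PiE UNIV (\<lambda>i::'a. {0..1::real}))"
    by (simp add: euclidean_product_topology)
  moreover have "PiE UNIV (\<lambda>i::'a. {0..1::real}) = {g. \<forall>x. g x \<in> {0..1}}"
    by (auto simp: PiE_def Pi_def)
  ultimately show ?thesis by (simp add: compactin_euclidean_iff)
qed

text \<open>A cluster point replaces a subsequential limit, because a cube over an uncountable index
  type need not be sequentially compact. One \<open>\<mu>\<close> serves all continuous test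
  functionals at once.\<close>

lemma cluster_point:
  fixes \<nu> :: "nat \<Rightarrow> 'a \<Rightarrow> real"
  assumes "\<And>N x. \<nu> N x \<in> {0..1}"
  obtains \<mu> where "\<And>x. \<mu> x \<in> {0..1}"
    and "\<And>\<phi> c. continuous_on UNIV \<phi> \<Longrightarrow> (\<lambda>N. \<phi> (\<nu> N)) \<longlonglongrightarrow> (c::real) \<Longrightarrow> \<phi> \<mu> = c"
proof -
  let ?F = "filtermap \<nu> sequentially"
  have "?F \<noteq> bot" by (simp add: filtermap_bot_iff)
  moreover have "eventually (\<lambda>g. g \<in> {g. \<forall>x. g x \<in> {0..1}}) ?F"
    using assms by (simp add: eventually_filtermap)
  ultimately obtain \<mu> where \<mu>: "\<mu> \<in> {g. \<forall>x. g x \<in> {0..1}}" "inf (nhds \<mu>) ?F \<noteq> bot"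
    using compact_cube[where 'a='a] unfolding compact_filter by meson
  show thesis
  proof (rule that)
    show "\<mu> x \<in> {0..1}" for x using \<mu> by auto
  next
    fix \<phi> :: "('a \<Rightarrow> real) \<Rightarrow> real" and c
    assume "continuous_on UNIV \<phi>" and c: "(\<lambda>N. \<phi> (\<nu> N)) \<longlonglongrightarrow> c"
    then have "(\<phi> \<longlongrightarrow> \<phi> \<mu>) (nhds \<mu>)"
      unfolding continuous_on_def tendsto_at_iff_tendsto_nhds[symmetric] by blast
    then have 1: "(\<phi> \<longlongrightarrow> \<phi> \<mu>) (inf (nhds \<mu>) ?F)"
      by (rule tendsto_mono[rotated]) simp
    have "(\<phi> \<longlongrightarrow> c) ?F" using c by (simp add: filterlim_def filtermap_filtermap)
    then have 2: "(\<phi> \<longlongrightarrow> c) (inf (nhds \<mu>) ?F)"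
      by (rule tendsto_mono[rotated]) simp
    show "\<phi> \<mu> = c" using tendsto_unique[OF \<mu>(2) 1 2] .
  qed
qed

text \<open>With index type \<open>'a set\<close>, a cluster point of the normalised counting
  measures is itself a set function. Total mass, additivity and invariance each involve at most
  three coordinates, so they are continuous conditions and survive in the limit.\<close>

lemma left_amenable_Folner:
  fixes F :: "nat \<Rightarrow> 'a set"
  assumes F: "\<And>N. finite (F N)" "\<And>N. F N \<subseteq> T"
    and ne: "eventually (\<lambda>N. F N \<noteq> {}) sequentially"
    and folner: "\<And>a X. a \<in> T \<Longrightarrow> X \<subseteq> T \<Longrightarrow>
      (\<lambda>N. (real (card {s \<in> F N. f a s \<in> X}) - real (card (X \<inter> F N))) / real (card (F N))) \<longlonglongrightarrow> 0"
  shows "left_amenable f T"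
proof -
  define \<nu> where "\<nu> N X = real (card (X \<inter> F N)) / real (card (F N))" for N X
  \<comment> \<open>An empty \<open>F N\<close> is covered as well: division by zero gives
    0.\<close>
  have "\<nu> N X \<in> {0..1}" for N X
    unfolding \<nu>_def using F(1)[of N] card_mono[of "F N" "X \<inter> F N"]
    by (cases "card (F N) = 0") (auto simp: divide_simps)
  then obtain \<mu> where \<mu>: "\<And>X. \<mu> X \<in> {0..1}"
    "\<And>\<phi> c. continuous_on UNIV \<phi> \<Longrightarrow> (\<lambda>N. \<phi> (\<nu> N)) \<longlonglongrightarrow> (c::real) \<Longrightarrow> \<phi> \<mu> = c"
    using cluster_point[of \<nu>] by metis
  have "\<mu> T = 1"
  proof (rule \<mu>(2))
    have "eventually (\<lambda>N. \<nu> N T = 1) sequentially"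
      using ne
    proof eventually_elim
      case (elim N)
      have "T \<inter> F N = F N" using F by auto
      then show ?case using elim F(1)[of N] by (simp add: \<nu>_def)
    qed
    then show "(\<lambda>N. \<nu> N T) \<longlonglongrightarrow> 1" by (rule tendsto_eventually)
  qed (rule continuous_on_product_coordinates)
  moreover have "\<mu> (X \<union> Y) = \<mu> X + \<mu> Y" if "X \<inter> Y = {}" for X Y
  proof -
    have "\<mu> (X \<union> Y) - (\<mu> X + \<mu> Y) = 0"
    proof (rule \<mu>(2))
      have "\<nu> N (X \<union> Y) - (\<nu> N X + \<nu> N Y) = 0" for N
      proof -
        have "card ((X \<union> Y) \<inter> F N) = card (X \<inter> F N) + card (Y \<inter> F N)"
          using that F(1)[of N] by (subst card_Un_disjoint[symmetric]) (auto simp: Int_Un_distrib2)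
        then show ?thesis by (simp add: \<nu>_def add_divide_distrib)
      qed
      then show "(\<lambda>N. \<nu> N (X \<union> Y) - (\<nu> N X + \<nu> N Y)) \<longlonglongrightarrow> 0" by simp
    qed (intro continuous_intros continuous_on_product_coordinates)
    then show ?thesis by simp
  qed
  moreover have "\<mu> {s \<in> T. f a s \<in> X} = \<mu> X" if "a \<in> T" "X \<subseteq> T" for a X
  proof -
    have "\<mu> {s \<in> T. f a s \<in> X} - \<mu> X = 0"
    proof (rule \<mu>(2))
      have "\<nu> N {s \<in> T. f a s \<in> X} - \<nu> N X =
        (real (card {s \<in> F N. f a s \<in> X}) - real (card (X \<inter> F N))) / real (card (F N))" for N
      proof -
        have "{s \<in> T. f a s \<in> X} \<inter> F N = {s \<in> F N. f a s \<in> X}" using F(2)[of N] by auto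
        then show ?thesis by (simp add: \<nu>_def diff_divide_distrib)
      qed
      then show "(\<lambda>N. \<nu> N {s \<in> T. f a s \<in> X} - \<nu> N X) \<longlonglongrightarrow> 0"
        using folner[OF that] by simp
    qed (intro continuous_intros continuous_on_product_coordinates)
    then show ?thesis by simp
  qed
  ultimately show ?thesis
    unfolding left_amenable_def finitely_additive_probability_def Measure_Space.additive_def
    using \<mu>(1) by (intro exI[of _ \<mu>]) auto
qed

text \<open>Translation by \<open>a\<close> takes elements of level at most N out of that range only
  into the next \<open>lev a\<close> levels. These hold at most \<open>lev a * M\<close> elements, a
  bound independent of N.\<close>

lemma left_amenable_graded:
  fixes f :: "'a \<Rightarrow> 'a \<Rightarrow> 'a" and lev :: "'a \<Rightarrow> nat"
  assumes closed: "\<And>a b. a \<in> T \<Longrightarrow> b \<in> T \<Longrightarrow> f a b \<in> T" and ne: "T \<noteq> {}"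
    and lev: "\<And>a b. a \<in> T \<Longrightarrow> b \<in> T \<Longrightarrow> lev (f a b) = lev a + lev b"
    and fin: "\<And>k. finite {t \<in> T. lev t = k}" and M: "\<And>k. card {t \<in> T. lev t = k} \<le> M"
    and inj: "\<And>a. a \<in> T \<Longrightarrow> inj_on (f a) T"
  shows "left_amenable f T"
proof -
  define F where "F N = {t \<in> T. lev t \<le> N}" for N
  have F_UN: "{t \<in> T. lev t \<in> K} = (\<Union>k\<in>K. {t \<in> T. lev t = k})" for K by auto
  have fin': "finite {t \<in> T. lev t \<in> K}" and card': "card {t \<in> T. lev t \<in> K} \<le> card K * M"
    if "finite K" for K
  proof -
    show "finite {t \<in> T. lev t \<in> K}" unfolding F_UN using fin that by auto
    have "card (\<Union>k\<in>K. {t \<in> T. lev t = k}) \<le> (\<Sum>k\<in>K. card {t \<in> T. lev t = k})"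
      by (rule card_UN_le[OF that])
    also have "\<dots> \<le> card K * M" using sum_bounded_above[of K _ M] M by simp
    finally show "card {t \<in> T. lev t \<in> K} \<le> card K * M" unfolding F_UN .
  qed
  have finF: "finite (F N)" for N using fin'[of "{..N}"] by (simp add: F_def)
  have FT: "F N \<subseteq> T" for N by (auto simp: F_def)
  obtain t0 where t0: "t0 \<in> T" using ne by auto
  have bound: "\<bar>real (card {s \<in> F N. f a s \<in> X}) - real (card (X \<inter> F N))\<bar> \<le> real (lev a * M)"
    if a: "a \<in> T" and X: "X \<subseteq> T" for a X N
  proof -
    let ?G = "f a ` F N" and ?D = "{t \<in> T. lev t \<in> {N<..N + lev a}}"
    have D: "finite ?D" "card ?D \<le> lev a * M"
      using fin'[of "{N<..N + lev a}"] card'[of "{N<..N + lev a}"] by simp_all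
    have injF: "inj_on (f a) (F N)" using inj[OF a] FT by (rule inj_on_subset)
    have GD: "?G \<subseteq> F N \<union> ?D" using closed lev a by (auto simp: F_def)
    have img: "card {s \<in> F N. f a s \<in> Y} = card (Y \<inter> ?G)" for Y
    proof -
      have "f a ` {s \<in> F N. f a s \<in> Y} = Y \<inter> ?G" by auto
      moreover have "inj_on (f a) {s \<in> F N. f a s \<in> Y}" using injF by (rule inj_on_subset) auto
      ultimately show ?thesis by (metis card_image)
    qed
    have le: "card (Y \<inter> ?G) \<le> card (Y \<inter> F N) + lev a * M" for Y
    proof -
      have "card (Y \<inter> ?G) \<le> card ((Y \<inter> F N) \<union> ?D)"
        using GD finF D by (intro card_mono) auto
      also have "\<dots> \<le> card (Y \<inter> F N) + card ?D" by (rule card_Un_le)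
      finally show ?thesis using D by simp
    qed
    \<comment> \<open>Passing to complements turns the upper bound \<open>le\<close> into the
      matching lower bound, since \<open>?G\<close> and \<open>F N\<close> have the same
      size.\<close>
    have compl: "card (X \<inter> A) + card (- X \<inter> A) = card A" if "finite A" for A
    proof -
      have "card ((X \<inter> A) \<union> (- X \<inter> A)) = card (X \<inter> A) + card (- X \<inter> A)"
        using that by (intro card_Un_disjoint) auto
      moreover have "(X \<inter> A) \<union> (- X \<inter> A) = A" by auto
      ultimately show ?thesis by simp
    qed
    have "card ?G = card (F N)" using injF by (rule card_image)
    then have "card (X \<inter> F N) \<le> card (X \<inter> ?G) + lev a * M"
      using le[of "- X"] compl[of "F N"] compl[of ?G] finF[of N] by simp
    moreover have "\<bar>real x - real y\<bar> \<le> real m" if "x \<le> y + m" "y \<le> x + m" for x y m :: nat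
      using that by linarith
    ultimately show ?thesis unfolding img using le[of X] by blast
  qed
  show ?thesis
  proof (rule left_amenable_Folner[of F])
    show "eventually (\<lambda>N. F N \<noteq> {}) sequentially"
      using eventually_ge_at_top[of "lev t0"] by eventually_elim (use t0 in \<open>auto simp: F_def\<close>)
  next
    fix a X assume a: "a \<in> T" and X: "X \<subseteq> T"
    let ?q = "\<lambda>N. (real (card {s \<in> F N. f a s \<in> X}) - real (card (X \<inter> F N))) / real (card (F N))"
    show "?q \<longlonglongrightarrow> 0"
    \<comment> \<open>At level 0 the numerator vanishes exactly; this matters because
      \<open>F N\<close> may then stay bounded.\<close>
    proof (cases "lev a = 0")
      case True
      then show ?thesis using bound[OF a X] by simp
    next
      case False
      \<comment> \<open>\<open>p i\<close> is the power of \<open>a\<close> with i + 1 factors.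
        These powers have different levels, and the first \<open>N div lev a\<close> of them lie in
        \<open>F N\<close>.\<close>
      define p where "p i = (f a ^^ i) a" for i
      have p: "p i \<in> T \<and> lev (p i) = Suc i * lev a" for i
        by (induction i) (use a closed lev in \<open>auto simp: p_def\<close>)
      have le: "card (F N) \<ge> N div lev a" for N
      proof -
        have "inj_on p {..<N div lev a}"
          using p False by (intro inj_onI) (metis mult_cancel2 nat.inject)
        moreover have "p ` {..<N div lev a} \<subseteq> F N"
        proof clarify
          fix i assume "i < N div lev a"
          then have "Suc i * lev a \<le> (N div lev a) * lev a" by (intro mult_le_mono1) simp
          then show "p i \<in> F N" using p[of i] by (simp add: F_def) (metis div_times_less_eq_dividend order.trans)
        qed
        ultimately show ?thesis using card_inj_on_le[OF _ _ finF[of N]] by fastforce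
      qed
      have "filterlim (\<lambda>N. N div lev a) at_top sequentially"
        using False by (intro filterlim_at_top_div_const_nat) simp
      then have "filterlim (\<lambda>N. card (F N)) at_top sequentially"
        by (rule filterlim_at_top_mono) (simp add: le)
      then have "filterlim (\<lambda>N. real (card (F N))) at_top sequentially"
        by (rule filterlim_compose[OF filterlim_real_sequentially])
      then have "(\<lambda>N. real (lev a * M) / real (card (F N))) \<longlonglongrightarrow> 0"
        by (intro tendsto_divide_0[OF tendsto_const] filterlim_at_top_imp_at_infinity)
      then show ?thesis
      proof (rule Lim_null_comparison[rotated])
        show "eventually (\<lambda>N. norm (?q N) \<le> real (lev a * M) / real (card (F N))) sequentially"
          using bound[OF a X] by (auto intro!: always_eventually divide_right_mono)
      qed
    qed
  qed (use finF FT in auto)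
qed

lemma right_amenable_flip: "right_amenable f T \<longleftrightarrow> left_amenable (\<lambda>x y. f y x) T"
  by (simp add: right_amenable_def left_amenable_def)

section \<open>Moebius maps\<close>

lemma moebiusE:
  assumes "f \<in> moebius"
  obtains a b c d where "a * d - b * c \<noteq> 0" "f = rat_map [:b, a:] [:d, c:]"
  using assms unfolding moebius_def by blast

lemma moebiusI: "a * d - b * c \<noteq> 0 \<Longrightarrow> rat_map [:b, a:] [:d, c:] \<in> moebius"
  unfolding moebius_def by blast

lemma moebius_bij: "f \<in> moebius \<Longrightarrow> bij f"
  using moebius_inv o_bij by blast

text \<open>Finite fixed points solve c z^2 + (d - a) z - b = 0. Infinity is fixed only if c = 0,
  and then the degree of this polynomial drops to at most 1, so the total stays at most 2.\<close>

lemma moebius_fixed_points: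
  assumes "f \<in> moebius" "f \<noteq> id"
  shows "finite {x. f x = x}" "card {x. f x = x} \<le> 2"
proof -
  obtain a b c d where D: "a * d - b * c \<noteq> 0" and f: "f = rat_map [:b, a:] [:d, c:]"
    using assms(1) by (rule moebiusE)
  define P where "P = [:- b, d - a, c:]"
  have "P \<noteq> 0"
  proof
    assume "P = 0"
    then have "b = 0" "c = 0" "d = a" by (auto simp: P_def)
    then have "f = id" using D f rat_map_scalar_id[of a] by auto
    then show False using assms by simp
  qed
  have sub: "{x. f x = x} \<subseteq> Some ` {z. poly P z = 0} \<union> (if c = 0 then {None} else {})"
  proof
    fix x assume "x \<in> {x. f x = x}"
    then have x: "f x = x" by simp
    show "x \<in> Some ` {z. poly P z = 0} \<union> (if c = 0 then {None} else {})"
    proof (cases x)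
      case None
      then show ?thesis using x unfolding f moebius_eval[OF D refl] by (auto split: if_splits)
    next
      case (Some z)
      then have nz: "c * z + d \<noteq> 0" and "(a * z + b) / (c * z + d) = z"
        using x unfolding f moebius_eval[OF D refl] by (auto split: if_splits)
      then have "a * z + b = z * (c * z + d)" by (simp add: divide_eq_eq)
      then have "poly P z = 0" by (simp add: P_def algebra_simps)
      then show ?thesis using Some by auto
    qed
  qed
  have fin: "finite {z. poly P z = 0}" using \<open>P \<noteq> 0\<close> by (rule poly_roots_finite)
  show "finite {x. f x = x}" using sub by (rule finite_subset) (use fin in auto)
  have "card {x. f x = x} \<le> card (Some ` {z. poly P z = 0} \<union> (if c = 0 then {None} else {}))"
    using sub fin by (intro card_mono) auto
  also have "\<dots> \<le> card (Some ` {z. poly P z = 0}) + card (if c = 0 then {None :: complex option} else {})"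
    by (rule card_Un_le)
  also have "\<dots> \<le> degree P + (if c = 0 then 1 else 0)"
    using card_image_le[OF fin, of Some] card_poly_roots_bound[OF \<open>P \<noteq> 0\<close>] by auto
  also have "\<dots> \<le> 2" by (auto simp: P_def)
  finally show "card {x. f x = x} \<le> 2" .
qed

lemma moebius_eqI:
  assumes "f \<in> moebius" "g \<in> moebius" "card A \<ge> 3" "\<And>x. x \<in> A \<Longrightarrow> f x = g x"
  shows "f = g"
proof -
  obtain h where h: "h \<in> moebius" "g \<circ> h = id" "h \<circ> g = id" using moebius_inv[OF assms(2)] by blast
  have "h \<circ> f = id"
  proof (rule ccontr)
    assume ne: "h \<circ> f \<noteq> id"
    have m: "h \<circ> f \<in> moebius" using h(1) assms(1) by (rule moebius_comp)
    have sub: "A \<subseteq> {x. (h \<circ> f) x = x}" using assms(4) h(3) by (auto simp: fun_eq_iff)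
    show False using card_mono[OF _ sub] moebius_fixed_points[OF m ne] assms(3) by linarith
  qed
  then have "g \<circ> (h \<circ> f) = g" by simp
  then show ?thesis using h by (simp add: comp_assoc[symmetric])
qed

text \<open>Three values determine a Moebius map, so restriction to \<open>A\<close> embeds the set
  into the finite set \<open>A \<rightarrow>\<^sub>E F\<close>.\<close>

lemma finite_moebius_into:
  assumes "card A \<ge> 3" "finite F"
  shows "finite {\<sigma> \<in> moebius. \<forall>x\<in>A. \<sigma> x \<in> F}"
proof -
  let ?M = "{\<sigma> \<in> moebius. \<forall>x\<in>A. \<sigma> x \<in> F}"
  have "finite A" using assms(1) card.infinite by fastforce
  then have "finite (A \<rightarrow>\<^sub>E F)" using assms(2) by (intro finite_PiE) auto
  moreover have "(\<lambda>\<sigma>. restrict \<sigma> A) ` ?M \<subseteq> A \<rightarrow>\<^sub>E F" by auto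
  moreover have "inj_on (\<lambda>\<sigma>. restrict \<sigma> A) ?M"
  proof (rule inj_onI)
    fix f g assume fg: "f \<in> ?M" "g \<in> ?M" "restrict f A = restrict g A"
    have "f x = g x" if "x \<in> A" for x using fun_cong[OF fg(3), of x] that by simp
    then show "f = g" using fg assms(1) by (intro moebius_eqI) auto
  qed
  ultimately show ?thesis using inj_on_finite by blast
qed

text \<open>Once infinity is sent to infinity, \<open>p - smult c q\<close> has degree
  \<open>n\<close> for every \<open>c\<close>, so no fibre over a finite value loses a root to
  infinity.\<close>

lemma rational_normalize_infinity:
  assumes "rational_of_degree n R" "n \<ge> 1"
  obtains \<tau> p q where "\<tau> \<in> moebius" "\<tau> \<circ> R = rat_map p q" "q \<noteq> 0" "coprime p q"
    "degree p = n" "degree q < n"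
proof -
  obtain p q where pq: "q \<noteq> 0" "coprime p q" "n = max (degree p) (degree q)" "R = rat_map p q"
    using assms(1) unfolding rational_of_degree_def by blast
  show thesis
  proof (cases "degree p > degree q")
    case True
    then show thesis using pq by (intro that[of id p q]) (auto simp: moebius_id)
  next
    case False
    then have n: "degree q = n" "degree p \<le> n" using pq by auto
    \<comment> \<open>\<open>c\<close> is the value of \<open>R\<close> at infinity and
      \<open>?\<tau>\<close> is w \<mapsto> 1 / (w - c), which makes \<open>q\<close> the new
      numerator.\<close>
    define c where "c = coeff p n / lead_coeff q"
    let ?q = "p - smult c q" and ?\<tau> = "rat_map [:1, 0:] [:- c, 1:]"
    have D: "0 * (- c) - 1 * 1 \<noteq> (0::complex)" by simp
    have cop: "coprime q ?q"
    proof (rule coprimeI)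
      fix r assume r: "r dvd q" "r dvd ?q"
      then have "r dvd ?q + smult c q" by (intro dvd_add dvd_smult)
      then have "r dvd p" by simp
      then show "is_unit r" using r pq(2) coprime_common_divisor by blast
    qed
    have "?q \<noteq> 0"
    proof
      assume "?q = 0"
      then have "is_unit q" using cop by simp
      then show False using n assms(2) by (simp add: is_unit_iff_degree pq(1))
    qed
    have dq: "degree ?q < n"
    proof -
      have "coeff ?q n = 0" using n pq(1) by (auto simp: c_def)
      moreover have "degree ?q \<le> n" using n by (intro degree_diff_le) auto
      ultimately show ?thesis using \<open>?q \<noteq> 0\<close> leading_coeff_0_iff[of ?q]
        by (cases "degree ?q = n") auto
    qed
    have "?\<tau> \<circ> R = rat_map q ?q"
    proof
      fix w show "(?\<tau> \<circ> R) w = rat_map q ?q w"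
      proof (cases w)
        case None
        then show ?thesis using False n dq unfolding o_def moebius_eval[OF D refl] pq(4)
          by (simp add: rat_map_def c_def)
      next
        case (Some z)
        have "poly p z = 0 \<and> poly q z = 0 \<Longrightarrow> False"
          using pq(2) coprime_poly_0 by blast
        moreover have "poly p z / poly q z - c = (poly p z - c * poly q z) / poly q z" if "poly q z \<noteq> 0"
          using that by (simp add: field_simps)
        ultimately show ?thesis using Some unfolding o_def moebius_eval[OF D refl] pq(4)
          by (auto simp: rat_map_def)
      qed
    qed
    then show thesis using n dq \<open>?q \<noteq> 0\<close> cop moebiusI[OF D] by (intro that[of ?\<tau> q ?q]) auto
  qed
qed

section \<open>Fibres with fewer than n points\<close>

lemma sum_order_eq_degree:
  fixes p :: "complex poly"
  assumes "p \<noteq> 0"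
  shows "(\<Sum>z | poly p z = 0. order z p) = degree p"
proof -
  have "degree p = degree (\<Prod>z | poly p z = 0. [:- z, 1:] ^ order z p)"
    by (subst complex_poly_decompose[of p, symmetric]) (use assms in simp)
  also have "\<dots> = (\<Sum>z | poly p z = 0. degree ([:- z, 1:] ^ order z p))"
    by (rule degree_prod_sum_eq) simp
  also have "\<dots> = (\<Sum>z | poly p z = 0. order z p)"
    by (simp add: degree_power_eq)
  finally show ?thesis by simp
qed

lemma card_roots_less_degree:
  fixes p :: "complex poly"
  assumes "p \<noteq> 0" "order z p \<ge> 2"
  shows "card {z. poly p z = 0} < degree p"
proof -
  have "card {z. poly p z = 0} = (\<Sum>z | poly p z = 0. 1)" by simp
  also have "\<dots> < (\<Sum>z | poly p z = 0. order z p)"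
  proof (rule sum_strict_mono_ex1)
    show "finite {z. poly p z = 0}" using assms(1) by (rule poly_roots_finite)
    show "\<forall>z\<in>{z. poly p z = 0}. 1 \<le> order z p"
      using assms(1) by (auto simp: Suc_le_eq order_gt_0_iff)
    have "poly p z = 0" using assms order_gt_0_iff[of p z] by simp
    then show "\<exists>z\<in>{z. poly p z = 0}. 1 < order z p" using assms(2) by (intro bexI[of _ z]) auto
  qed
  finally show ?thesis by (simp add: sum_order_eq_degree assms)
qed

lemma card_roots_rsquarefree:
  fixes p :: "complex poly"
  assumes "rsquarefree p"
  shows "card {z. poly p z = 0} = degree p"
proof -
  have nz: "p \<noteq> 0" and o: "\<And>z. order z p = 0 \<or> order z p = 1" 
    using assms by (auto simp: rsquarefree_def)
  have "order z p = 1" if "poly p z = 0" for z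
    using o[of z] that nz order_root[of p z] by simp
  then have "(\<Sum>z | poly p z = 0. order z p) = card {z. poly p z = 0}" by simp
  then show ?thesis using sum_order_eq_degree[OF nz] by simp
qed

lemma order_eq_degree:
  fixes f :: "complex poly"
  assumes "f \<noteq> 0" "order z f = degree f"
  shows "f = smult (lead_coeff f) ([:- z, 1:] ^ degree f)"
proof -
  have "[:- z, 1:] ^ degree f dvd f" using order_1[of z f] assms by simp
  then obtain g where g: "f = [:- z, 1:] ^ degree f * g" by (rule dvdE)
  then have g0: "g \<noteq> 0" using assms(1) by auto
  have "degree f = degree f + degree g"
    using g0 by (subst g) (simp add: degree_mult_eq degree_power_eq)
  then obtain e where "g = [:e:]" using degree_eq_zeroE by auto
  then have f: "f = smult e ([:- z, 1:] ^ degree f)" using g by simp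
  have "coeff ([:- z, 1:] ^ degree f) (degree f) = 1"
    using lead_coeff_power[of "[:- z, 1:]" "degree f"] by (simp add: degree_power_eq)
  then have "lead_coeff f = e" by (subst (1) f) simp
  then show ?thesis using f by simp
qed

text \<open>The numerator of the derivative of p / q. Exchanging p and q only changes its sign, so
  multiple poles are detected in the same way as multiple zeros.\<close>

definition wronskian :: "complex poly \<Rightarrow> complex poly \<Rightarrow> complex poly" where
  "wronskian p q = pderiv p * q - p * pderiv q"

text \<open>If f vanishes at z to order m, then \<open>pderiv f * g\<close> vanishes to order
  exactly m - 1 and \<open>f * pderiv g\<close> to order at least m; the lower order
  decides.\<close>

lemma order_wronskian:
  assumes "f \<noteq> 0" "poly f z = 0" "poly g z \<noteq> 0"
  shows "order z f = Suc (order z (wronskian f g))"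
proof -
  define k where "k = order z (pderiv f)"
  have f: "order z f = Suc k" using order_pderiv[OF assms(1,2)] by (simp add: k_def)
  have g: "g \<noteq> 0" using assms(3) by auto
  have d0: "pderiv f \<noteq> 0"
  proof
    assume "pderiv f = 0"
    then obtain h where "f = [:h:]" using pderiv_iszero by blast
    then show False using assms by simp
  qed
  have o: "order z (pderiv f * g) = k"
    using d0 g assms(3) by (simp add: order_mult k_def order_0I)
  have 1: "[:- z, 1:] ^ Suc k dvd f * pderiv g"
    using order_1[of z f] f by (metis dvd_mult2)
  have 2: "[:- z, 1:] ^ k dvd pderiv f * g" using order_1[of z "pderiv f * g"] o by simp
  have 3: "\<not> [:- z, 1:] ^ Suc k dvd pderiv f * g"
    using order_2[of "pderiv f * g" z] o d0 g by simp
  have "order z (wronskian f g) = k" unfolding wronskian_def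
  proof (rule order_unique_lemma)
    show "[:- z, 1:] ^ k dvd pderiv f * g - f * pderiv g"
      using 2 1 by (meson dvd_diff le_SucI order_refl power_le_dvd)
    show "\<not> [:- z, 1:] ^ Suc k dvd pderiv f * g - f * pderiv g"
    proof
      assume "[:- z, 1:] ^ Suc k dvd pderiv f * g - f * pderiv g"
      then have "[:- z, 1:] ^ Suc k dvd (pderiv f * g - f * pderiv g) + f * pderiv g"
        using 1 by (rule dvd_add)
      then show False using 3 by simp
    qed
  qed
  then show ?thesis using f by simp
qed

lemma wronskian_commute: "wronskian q p = - wronskian p q"
  by (simp add: wronskian_def mult.commute)

text \<open>Subtracting a constant from p / q does not change its derivative. A point with value
  \<open>c\<close> can thus be treated as a zero.\<close>

lemma wronskian_diff_smult: "wronskian (p - smult c q) q = wronskian p q"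
  by (simp add: wronskian_def pderiv_diff pderiv_smult algebra_simps)

text \<open>The top coefficients of the two products combine to a multiple of degree p - degree q,
  which does not cancel because the degrees differ.\<close>

lemma wronskian_nonzero_degree:
  assumes "degree q < degree p" "q \<noteq> 0"
  shows "wronskian p q \<noteq> 0" "degree (wronskian p q) = degree p + degree q - 1"
proof -
  let ?k = "degree p + degree q - 1"
  have p0: "p \<noteq> 0" using assms by auto
  have A: "degree (pderiv p) = degree p - 1" "degree (pderiv q) = degree q - 1"
    by (simp_all add: degree_pderiv)
  have k: "?k = degree (pderiv p) + degree q" using assms A by simp
  have c1: "coeff (pderiv p * q) ?k = of_nat (degree p) * lead_coeff p * lead_coeff q"
    unfolding k coeff_mult_degree_sum using assms A by (simp add: coeff_pderiv)
  have c2: "coeff (p * pderiv q) ?k = of_nat (degree q) * lead_coeff p * lead_coeff q"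
  \<comment> \<open>For constant \<open>q\<close> truncated subtraction makes
    \<open>degree (pderiv q)\<close> equal to \<open>degree q\<close> instead of one less.\<close>
  proof (cases "degree q = 0")
    case True
    then have "pderiv q = 0" by (simp add: pderiv_eq_0_iff)
    then show ?thesis using True by simp
  next
    case False
    then have k': "?k = degree p + degree (pderiv q)" using A by simp
    have "lead_coeff (pderiv q) = of_nat (degree q) * lead_coeff q"
      using False A by (simp add: coeff_pderiv)
    then show ?thesis unfolding k' coeff_mult_degree_sum by simp
  qed
  have "coeff (wronskian p q) ?k = (of_nat (degree p) - of_nat (degree q)) * lead_coeff p * lead_coeff q"
    unfolding wronskian_def coeff_diff c1 c2 by (simp add: left_diff_distrib)
  then have nz: "coeff (wronskian p q) ?k \<noteq> 0" using assms p0 by auto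
  then show "wronskian p q \<noteq> 0" by auto
  have "degree (pderiv p * q) \<le> ?k" using degree_mult_le[of "pderiv p" q] k by simp
  moreover have "degree (p * pderiv q) \<le> ?k"
  proof (cases "degree q = 0")
    case True
    then have "pderiv q = 0" by (simp add: pderiv_eq_0_iff)
    then show ?thesis by simp
  next
    case False
    then show ?thesis using degree_mult_le[of p "pderiv q"] A by simp
  qed
  ultimately have "degree (wronskian p q) \<le> ?k" unfolding wronskian_def by (rule degree_diff_le)
  then show "degree (wronskian p q) = ?k" using le_degree[OF nz] by simp
qed

text \<open>
  A deficient fibre contains a critical point, but its other points are included as well. This
  makes the set depend only on the cardinalities of fibres.
\<close>

definition deficient :: "nat \<Rightarrow> ('a \<Rightarrow> 'b) \<Rightarrow> 'a set" where
  "deficient n R = {x. card (R -` {R x}) < n}"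

lemma deficient_comp_inj: "inj \<tau> \<Longrightarrow> deficient n (\<tau> \<circ> R) = deficient n R"
  unfolding deficient_def vimage_def by (simp add: inj_eq)

text \<open>The normal form supplied by \<open>rational_normalize_infinity\<close>; infinity is a
  pole of order degree p - degree q.\<close>

locale polar_quotient =
  fixes p q :: "complex poly"
  assumes cop: "coprime p q" and deg: "degree q < degree p" and q0: "q \<noteq> 0"
begin

lemma no_common_root: "poly q z = 0 \<Longrightarrow> poly p z \<noteq> 0"
  using cop coprime_poly_0 by blast

lemma fibre_None: "rat_map p q -` {None} = insert None (Some ` {z. poly q z = 0})"
proof (rule Set.set_eqI)
  fix x show "x \<in> rat_map p q -` {None} \<longleftrightarrow> x \<in> insert None (Some ` {z. poly q z = 0})"
    using deg by (cases x) (auto simp: rat_map_def)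
qed

lemma fibre_Some: "rat_map p q -` {Some c} = Some ` {z. poly (p - smult c q) z = 0}"
proof (rule Set.set_eqI)
  fix x show "x \<in> rat_map p q -` {Some c} \<longleftrightarrow> x \<in> Some ` {z. poly (p - smult c q) z = 0}"
  proof (cases x)
    case (Some z)
    have "poly q z \<noteq> 0" if "poly (p - smult c q) z = 0" using that no_common_root[of z] by auto
    then show ?thesis using Some by (auto simp: rat_map_def divide_eq_eq)
  qed (use deg in \<open>auto simp: rat_map_def\<close>)
qed

lemma degree_fibre_poly: "degree (p - smult c q) = degree p"
  using deg degree_add_eq_left[of "- smult c q" p] degree_smult_le[of c q] by simp

lemma lead_coeff_fibre_poly: "lead_coeff (p - smult c q) = lead_coeff p"
  using deg unfolding degree_fibre_poly by (simp add: coeff_eq_0)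

lemma fibre_poly_nonzero: "p - smult c q \<noteq> 0"
  using degree_fibre_poly[of c] deg by (metis degree_0 not_less_zero)

lemma card_fibre_None: "card (rat_map p q -` {None}) = Suc (card {z. poly q z = 0})"
  unfolding fibre_None using poly_roots_finite[OF q0] by (simp add: card_image)

lemma card_fibre_Some: "card (rat_map p q -` {Some c}) = card {z. poly (p - smult c q) z = 0}"
  unfolding fibre_Some by (simp add: card_image)

lemma finite_fibre: "finite (rat_map p q -` {w})"
  by (cases w) (use poly_roots_finite[OF q0] poly_roots_finite[OF fibre_poly_nonzero]
      in \<open>simp_all add: fibre_None fibre_Some del: poly_diff poly_smult\<close>)

text \<open>Here and in \<open>order_wronskian_finite\<close>, the order of the Wronskian is one
  less than the local multiplicity of the quotient, read off from \<open>q\<close> at a pole and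
  from the fibre polynomial elsewhere.\<close>

lemma order_wronskian_pole:
  "poly q z = 0 \<Longrightarrow> order z q = Suc (order z (wronskian p q))"
  using order_wronskian[OF q0 _ no_common_root] wronskian_commute[of q p] by simp

lemma order_wronskian_finite:
  assumes "poly q z \<noteq> 0"
  shows "order z (p - smult (poly p z / poly q z) q) = Suc (order z (wronskian p q))"
  using order_wronskian[OF fibre_poly_nonzero _ assms, of "poly p z / poly q z"] assms
    wronskian_diff_smult by simp

text \<open>Such a root is a multiple root of its fibre polynomial, which therefore has too few
  distinct roots. For a pole this polynomial is \<open>q\<close>; infinity adds only one more point
  to the fibre.\<close>

lemma root_wronskian_in_deficient:
  assumes "poly (wronskian p q) z = 0"
  shows "Some z \<in> deficient (degree p) (rat_map p q)"
proof -
  have o: "order z (wronskian p q) \<ge> 1"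
    using assms order_gt_0_iff[OF wronskian_nonzero_degree(1)[OF deg q0], of z] by simp
  show ?thesis
  proof (cases "poly q z = 0")
    case True
    then have "order z q \<ge> 2" using o order_wronskian_pole[of z] by simp
    then have "card {z. poly q z = 0} < degree q" using q0 card_roots_less_degree by blast
    then show ?thesis using True deg by (simp add: deficient_def rat_map_def card_fibre_None)
  next
    case False
    let ?c = "poly p z / poly q z"
    have "order z (p - smult ?c q) \<ge> 2" using o order_wronskian_finite[OF False] by simp
    then have "card {z. poly (p - smult ?c q) z = 0} < degree p"
      using card_roots_less_degree[OF fibre_poly_nonzero] degree_fibre_poly by metis
    moreover have "rat_map p q (Some z) = Some ?c" using False by (simp add: rat_map_def)
    ultimately show ?thesis by (simp add: deficient_def card_fibre_Some del: poly_diff poly_smult)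
  qed
qed

lemma infinity_in_deficient:
  assumes "degree q + 2 \<le> degree p"
  shows "None \<in> deficient (degree p) (rat_map p q)"
proof -
  have "rat_map p q None = None" using deg by (simp add: rat_map_def)
  then show ?thesis using card_poly_roots_bound[OF q0] assms by (simp add: deficient_def card_fibre_None)
qed

text \<open>A multiple root of a fibre polynomial is a root of the Wronskian. Hence every fibre is
  full except possibly the polar one and the finitely many through roots of the Wronskian.\<close>

lemma finite_deficient: "finite (deficient (degree p) (rat_map p q))"
proof -
  let ?r = "rat_map p q" and ?Z = "{z. poly (wronskian p q) z = 0}"
  have "deficient (degree p) ?r \<subseteq> ?r -` {None} \<union> (\<Union>z\<in>?Z. ?r -` {?r (Some z)})"
  proof (rule subsetI, rule ccontr)
    fix x assume x: "x \<in> deficient (degree p) ?r" and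
      n: "x \<notin> ?r -` {None} \<union> (\<Union>z\<in>?Z. ?r -` {?r (Some z)})"
    obtain c where c: "?r x = Some c" using n by auto
    have "rsquarefree (p - smult c q)"
      unfolding rsquarefree_roots
    proof (intro allI notI)
      fix z assume z: "poly (p - smult c q) z = 0 \<and> poly (pderiv (p - smult c q)) z = 0"
      have "poly (wronskian (p - smult c q) q) z = 0"
        using z by (simp add: wronskian_def del: poly_diff) (simp add: z)
      then have "z \<in> ?Z" by (simp add: wronskian_diff_smult)
      moreover have "Some z \<in> ?r -` {Some c}" unfolding fibre_Some using z by blast
      ultimately show False using n c by auto
    qed
    then show False using x c card_roots_rsquarefree degree_fibre_poly
      by (simp add: deficient_def card_fibre_Some del: poly_diff poly_smult)
  qed
  moreover have "finite ?Z" using wronskian_nonzero_degree(1)[OF deg q0] by (rule poly_roots_finite)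
  ultimately show ?thesis using finite_fibre by (auto intro: finite_subset)
qed

end

section \<open>Two ramified points force a power map\<close>

context polar_quotient
begin

lemma wronskian_root_bound:
  assumes "poly q z \<noteq> 0"
  shows "Suc (order z (wronskian p q)) \<le> degree p"
  using order_wronskian_finite[OF assms] order_degree[OF fibre_poly_nonzero] degree_fibre_poly
  by metis

lemma wronskian_pole_bound:
  assumes "poly q z = 0"
  shows "Suc (order z (wronskian p q)) \<le> degree q"
  using order_wronskian_pole[OF assms] order_degree[OF q0] by metis

text \<open>When the local multiplicity equals the degree, the fibre polynomial has no room for a
  second root.\<close>

lemma total_ramification:
  assumes "poly q z \<noteq> 0" "Suc (order z (wronskian p q)) = degree p"
  obtains c where "p - smult c q = smult (lead_coeff p) ([:- z, 1:] ^ degree p)"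
proof -
  let ?f = "p - smult (poly p z / poly q z) q"
  have "order z ?f = degree ?f"
    using order_wronskian_finite[OF assms(1)] assms(2) degree_fibre_poly by simp
  then have "?f = smult (lead_coeff ?f) ([:- z, 1:] ^ degree ?f)"
    by (rule order_eq_degree[OF fibre_poly_nonzero])
  then show thesis using that lead_coeff_fibre_poly degree_fibre_poly by metis
qed

text \<open>The quotient is (a / e) (x - z)^n + c, a power between two affine maps.\<close>

lemma polynomial_power:
  assumes "q = [:e:]" and c: "p - smult c q = smult a ([:- z, 1:] ^ degree p)"
  shows "\<exists>M1\<in>moebius. \<exists>M2\<in>moebius. rat_map p q = M1 \<circ> pow_map (degree p) \<circ> M2"
proof -
  let ?n = "degree p"
  have e: "e \<noteq> 0" using assms(1) q0 by simp
  have n: "?n > 0" using deg by simp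
  have a: "a \<noteq> 0" using fibre_poly_nonzero[of c] c by auto
  have D1: "(a / e) * 1 - c * 0 \<noteq> 0" and D2: "1 * 1 - (- z) * 0 \<noteq> (0::complex)" using a e by simp_all
  let ?M1 = "rat_map [:c, a / e:] [:1, 0:]" and ?M2 = "rat_map [:- z, 1:] [:1, 0:]"
  have p: "poly p x = a * (x - z) ^ ?n + c * e" for x
  proof -
    have "poly (p - smult c q) x = a * (x - z) ^ ?n" unfolding c by (simp add: poly_power)
    then show ?thesis using assms(1) by (simp add: algebra_simps)
  qed
  have "rat_map p q = ?M1 \<circ> pow_map ?n \<circ> ?M2"
  proof
    fix w show "rat_map p q w = (?M1 \<circ> pow_map ?n \<circ> ?M2) w"
    proof (cases w)
      case None
      then show ?thesis using n assms(1)
        unfolding o_def moebius_eval[OF D1 refl] moebius_eval[OF D2 refl]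
        by (simp add: pow_map_def rat_map_def degree_monom_eq)
    next
      case (Some x)
      then show ?thesis using e assms(1)
        unfolding o_def moebius_eval[OF D1 refl] moebius_eval[OF D2 refl]
        by (simp add: pow_map_def rat_map_def p poly_monom add_divide_distrib)
    qed
  qed
  then show ?thesis using moebiusI[OF D1] moebiusI[OF D2] by blast
qed

text \<open>Dividing the hypotheses gives (w - c1) / (w - c2) = u for w = p / q and u = ((x - z1) /
  (x - z2))^n. Solving for w yields \<open>?M1\<close>, that is u \<mapsto> (c2 u - c1) / (u -
  1).\<close>

lemma two_point_power:
  assumes c1: "p - smult c1 q = smult (lead_coeff p) ([:- z1, 1:] ^ degree p)"
    and c2: "p - smult c2 q = smult (lead_coeff p) ([:- z2, 1:] ^ degree p)"
    and z: "z1 \<noteq> z2"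
  shows "\<exists>M1\<in>moebius. \<exists>M2\<in>moebius. rat_map p q = M1 \<circ> pow_map (degree p) \<circ> M2"
proof -
  let ?n = "degree p" and ?a = "lead_coeff p"
  have n: "?n > 0" using deg by simp
  have a: "?a \<noteq> 0" using n by auto
  define A B where "A x = (x - z1) ^ ?n" and "B x = (x - z2) ^ ?n" for x
  have P: "poly p x - c1 * poly q x = ?a * A x" "poly p x - c2 * poly q x = ?a * B x" for x
  proof -
    have "poly (p - smult c1 q) x = ?a * A x" unfolding c1 A_def by (simp add: poly_power)
    then show "poly p x - c1 * poly q x = ?a * A x" by simp
    have "poly (p - smult c2 q) x = ?a * B x" unfolding c2 B_def by (simp add: poly_power)
    then show "poly p x - c2 * poly q x = ?a * B x" by simp
  qed
  have c: "c1 \<noteq> c2"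
  proof
    assume "c1 = c2"
    then have "A z1 = B z1" using P[of z1] a by (metis mult_cancel_left)
    moreover have "A z1 = 0" "B z1 \<noteq> 0" using z n by (simp_all add: A_def B_def)
    ultimately show False by simp
  qed
  have qAB: "(c2 - c1) * poly q x = ?a * (A x - B x)" for x
    using P[of x] by algebra
  have pAB: "(c2 - c1) * poly p x = ?a * (c2 * A x - c1 * B x)" for x
    using P[of x] by algebra
  have D1: "c2 * (- 1) - (- c1) * 1 \<noteq> 0" and D2: "1 * (- z2) - (- z1) * 1 \<noteq> 0" using c z by simp_all
  let ?M1 = "rat_map [:- c1, c2:] [:- 1, 1:]" and ?M2 = "rat_map [:- z1, 1:] [:- z2, 1:]"
  have "rat_map p q = ?M1 \<circ> pow_map ?n \<circ> ?M2"
  proof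
    fix w show "rat_map p q w = (?M1 \<circ> pow_map ?n \<circ> ?M2) w"
    proof (cases w)
      \<comment> \<open>Infinity goes to 1 under \<open>?M2\<close>, stays there under the power,
        and 1 is the pole of \<open>?M1\<close>.\<close>
      case None
      then show ?thesis using deg
        unfolding o_def moebius_eval[OF D1 refl] moebius_eval[OF D2 refl]
        by (simp add: pow_map_def rat_map_def poly_monom)
    next
      case (Some x)
      show ?thesis
      proof (cases "x = z2")
        case True
        have B0: "B x = 0" using True n by (simp add: B_def)
        have "A x \<noteq> 0" using True z by (simp add: A_def)
        then have q: "poly q x \<noteq> 0" using qAB[of x] B0 a by auto
        have "poly p x / poly q x = c2" using P(2)[of x] B0 q by (simp add: field_simps)
        then show ?thesis using Some True q n
          unfolding o_def moebius_eval[OF D1 refl] moebius_eval[OF D2 refl]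
          by (simp add: pow_map_def rat_map_def degree_monom_eq)
      next
        case False
        have B0: "B x \<noteq> 0" using False by (simp add: B_def)
        define u where "u = A x / B x"
        have M2: "pow_map ?n (?M2 w) = Some u" using Some False
          unfolding moebius_eval[OF D2 refl]
          by (simp add: pow_map_def rat_map_def poly_monom u_def A_def B_def power_divide)
        have q: "poly q x = 0 \<longleftrightarrow> u = 1"
          using qAB[of x] a c B0 by (auto simp: u_def divide_eq_1_iff)
        have "poly p x / poly q x = (c2 * u - c1) / (u - 1)" if "u \<noteq> 1"
        proof -
          have AB: "A x \<noteq> B x" using that B0 by (auto simp: u_def)
          have "poly p x / poly q x = ((c2 - c1) * poly p x) / ((c2 - c1) * poly q x)" using c by simp
          also have "\<dots> = (c2 * A x - c1 * B x) / (A x - B x)" unfolding pAB qAB using a by simp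
          also have "\<dots> = ((c2 * u - c1) * B x) / ((u - 1) * B x)"
            using B0 by (simp add: u_def algebra_simps)
          also have "\<dots> = (c2 * u - c1) / (u - 1)" using B0 by simp
          finally show ?thesis .
        qed
        then show ?thesis using q Some
          unfolding o_def M2 moebius_eval[OF D1 refl]
          by (simp add: rat_map_def)
      qed
    qed
  qed
  then show ?thesis using moebiusI[OF D1] moebiusI[OF D2] by blast
qed

text \<open>
  The Wronskian has degree deg p + deg q - 1 and each of its roots has multiplicity below deg p.
  With at most two ramified points every inequality in this count is an equality, so both points
  are totally ramified.
\<close>

lemma two_ramified_points:
  assumes "degree p \<ge> 2" and E: "card (deficient (degree p) (rat_map p q)) \<le> 2"
  shows "\<exists>M1\<in>moebius. \<exists>M2\<in>moebius. rat_map p q = M1 \<circ> pow_map (degree p) \<circ> M2"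
proof -
  let ?W = "wronskian p q" and ?n = "degree p" and ?E = "deficient (degree p) (rat_map p q)"
  let ?Z = "{z. poly ?W z = 0}"
  note W = wronskian_nonzero_degree[OF deg q0]
  have finZ: "finite ?Z" using W(1) by (rule poly_roots_finite)
  have sum: "(\<Sum>z\<in>?Z. order z ?W) = ?n + degree q - 1"
    using sum_order_eq_degree[OF W(1)] W(2) by simp
  have ZE: "Some ` ?Z \<subseteq> ?E" using root_wronskian_in_deficient by auto
  have ord: "Suc (order z ?W) \<le> ?n" for z
    using wronskian_root_bound[of z] wronskian_pole_bound[of z] deg
    by (cases "poly q z = 0") auto
  have cS: "card (Some ` ?Z) = card ?Z" by (simp add: card_image)
  show ?thesis
  \<comment> \<open>The split decides whether infinity is ramified. If it is, only one finite root
    of the Wronskian remains; its order n + degree q - 1 must be below n, which forces a constant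
    denominator.\<close>
  proof (cases "degree q + 2 \<le> ?n")
    case True
    have "insert None (Some ` ?Z) \<subseteq> ?E" using infinity_in_deficient[OF True] ZE by simp
    then have "card (insert None (Some ` ?Z)) \<le> 2" using E finite_deficient card_mono order_trans by blast
    then have "card ?Z \<le> 1" using finZ cS by (simp add: card_insert_if image_iff)
    moreover have "?Z \<noteq> {}"
    proof
      assume "?Z = {}"
      then show False using sum assms(1) by (simp only: sum.empty)
    qed
    ultimately have "card ?Z = 1" using finZ by (simp add: card_gt_0_iff le_antisym Suc_leI)
    then obtain z where Z: "?Z = {z}" by (rule card_1_singletonE)
    then have o: "order z ?W = ?n + degree q - 1" using sum by simp
    have nz: "poly q z \<noteq> 0" using wronskian_pole_bound[of z] o deg by force
    have "degree q = 0" using ord[of z] o assms by simp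
    then obtain e where "q = [:e:]" by (rule degree_eq_zeroE)
    moreover obtain c where "p - smult c q = smult (lead_coeff p) ([:- z, 1:] ^ ?n)"
      using total_ramification[OF nz] o \<open>degree q = 0\<close> assms by auto
    ultimately show ?thesis by (rule polynomial_power)
  next
    case False
    \<comment> \<open>Infinity is now a simple pole, and the Wronskian has degree 2 (n - 1), the
      most that two roots can carry.\<close>
    then have m: "degree q = ?n - 1" using deg by simp
    have S: "(\<Sum>z\<in>?Z. order z ?W) = 2 * (?n - 1)" using sum m assms by simp
    have "card ?Z \<le> 2" using card_mono[OF finite_deficient ZE] E cS by simp
    moreover have "2 * (?n - 1) \<le> card ?Z * (?n - 1)"
    proof -
      have "order z ?W \<le> ?n - 1" for z using ord[of z] by simp
      then show ?thesis using sum_bounded_above[of ?Z "\<lambda>z. order z ?W" "?n - 1"] S by simp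
    qed
    ultimately have "card ?Z = 2" using assms by simp
    then obtain z1 z2 where Z: "?Z = {z1, z2}" "z1 \<noteq> z2" by (auto simp: card_2_iff)
    have s: "order z1 ?W + order z2 ?W = 2 * (?n - 1)" using S Z by simp
    have o: "Suc (order z1 ?W) = ?n" "Suc (order z2 ?W) = ?n"
      using ord[of z1] ord[of z2] s assms by linarith+
    \<comment> \<open>A finite pole has multiplicity at most degree q, so it cannot be totally
      ramified.\<close>
    have "poly q z1 \<noteq> 0" "poly q z2 \<noteq> 0"
      using wronskian_pole_bound[of z1] wronskian_pole_bound[of z2] o deg by auto
    then obtain c1 c2 where "p - smult c1 q = smult (lead_coeff p) ([:- z1, 1:] ^ ?n)"
      "p - smult c2 q = smult (lead_coeff p) ([:- z2, 1:] ^ ?n)"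
      using total_ramification o by metis
    then show ?thesis using Z(2) by (rule two_point_power)
  qed
qed

end

text \<open>Postcomposition with the normalising \<open>\<tau>\<close> keeps the fibres as sets; in
  the power form the outer factor absorbs its inverse.\<close>

lemma
  assumes "rational_of_degree n R" "n \<ge> 2"
  shows rational_finite_deficient: "finite (deficient n R)"
    and rational_finite_fibre: "finite (R -` {w})"
    and rational_two_ramified_points: "card (deficient n R) \<le> 2 \<Longrightarrow>
      \<exists>M1\<in>moebius. \<exists>M2\<in>moebius. R = M1 \<circ> pow_map n \<circ> M2"
proof -
  obtain \<tau> p q where *: "\<tau> \<in> moebius" "\<tau> \<circ> R = rat_map p q" "q \<noteq> 0" "coprime p q"
    "degree p = n" "degree q < n"
    using rational_normalize_infinity[OF assms(1)] assms(2) by (metis Suc_leD Suc_1 One_nat_def)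
  interpret polar_quotient p q by standard (use * in auto)
  have inj: "inj \<tau>" using moebius_bij[OF *(1)] by (rule bij_is_inj)
  then have deficient: "deficient n R = deficient n (rat_map p q)" using deficient_comp_inj *(2) by metis
  then show "finite (deficient n R)" using finite_deficient *(5) by simp
  have "R -` {w} \<subseteq> rat_map p q -` {\<tau> w}" unfolding *(2)[symmetric] by auto
  then show "finite (R -` {w})" using finite_fibre finite_subset by blast
  obtain \<tau>' where \<tau>': "\<tau>' \<in> moebius" "\<tau>' \<circ> \<tau> = id" using moebius_inv[OF *(1)] by blast
  have R: "R = \<tau>' \<circ> rat_map p q" unfolding *(2)[symmetric] using \<tau>'(2) by (simp add: comp_assoc[symmetric])
  assume "card (deficient n R) \<le> 2"
  then obtain M1 M2 where M: "M1 \<in> moebius" "M2 \<in> moebius" "rat_map p q = M1 \<circ> pow_map n \<circ> M2"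
    using two_ramified_points *(5) assms(2) deficient by auto
  then have "R = (\<tau>' \<circ> M1) \<circ> pow_map n \<circ> M2" unfolding R by (simp add: comp_assoc)
  then show "\<exists>M1\<in>moebius. \<exists>M2\<in>moebius. R = M1 \<circ> pow_map n \<circ> M2"
    using moebius_comp[OF \<tau>'(1) M(1)] M(2) by blast
qed

section \<open>Finiteness of the symmetry group\<close>

lemma complex_root_exists:
  fixes w :: complex
  assumes "k > 0"
  obtains z where "z ^ k = w"
proof -
  have "degree (monom 1 k + [:- w:]) = k"
    using assms degree_add_eq_left[of "[:- w:]" "monom 1 k"] by (simp add: degree_monom_eq)
  then obtain z where "poly (monom 1 k + [:- w:]) z = 0"
    using fundamental_theorem_of_algebra[of "monom 1 k + [:- w:]"] assms
    by (auto simp: constant_degree simp del: poly_add)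
  then show thesis using that[of z] by (simp add: poly_monom)
qed

lemma pow_map_simps:
  assumes "n > 0"
  shows "pow_map n None = None" "pow_map n (Some z) = Some (z ^ n)"
  using assms by (simp_all add: pow_map_def rat_map_def degree_monom_eq poly_monom)

lemma neg_pow_map_simps:
  assumes "n > 0"
  shows "neg_pow_map n None = Some 0"
    and "neg_pow_map n (Some z) = (if z = 0 then None else Some (1 / z ^ n))"
  using assms by (simp_all add: neg_pow_map_def rat_map_def degree_monom_eq poly_monom)

text \<open>Conjugation by \<open>M2\<close> turns \<open>M1 \<circ> P \<circ> M2\<close> into
  \<open>(M2 \<circ> M1) \<circ> P\<close>; it remains for \<open>L\<close> to absorb the factor
  \<open>M2 \<circ> M1\<close>.\<close>

lemma moebius_conjugateI:
  assumes "M1 \<in> moebius" "M2 \<in> moebius" "L \<in> moebius" "P' \<circ> L = L \<circ> (M2 \<circ> M1) \<circ> P"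
  shows "moebius_conjugate (M1 \<circ> P \<circ> M2) P'"
proof -
  let ?s = "L \<circ> M2"
  have s: "?s \<in> moebius" using assms by (intro moebius_comp)
  have "inv_into UNIV ?s \<circ> P' \<circ> ?s = inv_into UNIV ?s \<circ> (P' \<circ> L) \<circ> M2" by (simp add: comp_assoc)
  also have "\<dots> = (inv_into UNIV ?s \<circ> ?s) \<circ> M1 \<circ> P \<circ> M2" unfolding assms(4) by (simp add: comp_assoc)
  also have "inv_into UNIV ?s \<circ> ?s = id" using moebius_bij[OF s] by (simp add: bij_is_inj)
  finally have "inv_into UNIV ?s \<circ> P' \<circ> ?s = M1 \<circ> P \<circ> M2" by (simp only: id_comp)
  then show ?thesis unfolding moebius_conjugate_def using s by metis
qed

lemma moebius_scaling:
  assumes "l \<noteq> 0"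
  obtains L where "L \<in> moebius" "L None = None" "\<And>z. L (Some z) = Some (l * z)"
proof (rule that)
  have D: "l * 1 - 0 * 0 \<noteq> 0" using assms by simp
  show "rat_map [:0, l:] [:1, 0:] \<in> moebius" using D by (rule moebiusI)
  show "rat_map [:0, l:] [:1, 0:] None = None" "rat_map [:0, l:] [:1, 0:] (Some z) = Some (l * z)" for z
    using assms by (simp_all add: rat_map_def)
qed

text \<open>A Moebius map preserving {0, infinity} is a scaling or a scaled inversion. The inversion
  accounts for \<open>neg_pow_map\<close>, and the constant is removed by conjugation with another
  scaling.\<close>

lemma power_conjugate:
  assumes n: "n \<ge> 2" and M: "M1 \<in> moebius" "M2 \<in> moebius"
    and pres: "(M2 \<circ> M1) ` {Some 0, None} \<subseteq> {Some 0, None}"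
  shows "moebius_conjugate (M1 \<circ> pow_map n \<circ> M2) (pow_map n) \<or>
    moebius_conjugate (M1 \<circ> pow_map n \<circ> M2) (neg_pow_map n)"
proof -
  let ?M = "M2 \<circ> M1"
  have "?M \<in> moebius" using M by (intro moebius_comp)
  then obtain a b c d where D: "a * d - b * c \<noteq> 0" and f: "?M = rat_map [:b, a:] [:d, c:]"
    by (rule moebiusE)
  note ev = moebius_eval[OF D refl]
  have n0: "n > 0" using n by simp
  note P = pow_map_simps[OF n0] neg_pow_map_simps[OF n0]
  show ?thesis
  proof (cases "c = 0")
    case True
    then have ad: "a \<noteq> 0" "d \<noteq> 0" using D by auto
    have "?M (Some 0) \<in> {Some 0, None}" using pres by auto
    then have "b = 0" using True ad unfolding f ev by simp
    then have Ms: "?M None = None" "?M (Some z) = Some (a / d * z)" for z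
      using True ad unfolding f ev by simp_all
    \<comment> \<open>Conjugation by z \<mapsto> l z requires l^n = l (a / d);
      \<open>n \<ge> 2\<close> keeps the exponent positive.\<close>
    obtain l where l: "l ^ (n - 1) = a / d" using complex_root_exists[of "n - 1" "a / d"] n by auto
    have l0: "l \<noteq> 0" using l ad n by (auto simp: power_0_left split: if_splits)
    obtain L where L: "L \<in> moebius" "L None = None" "\<And>z. L (Some z) = Some (l * z)"
      using moebius_scaling[OF l0] by metis
    have ln: "l ^ n = l * (a / d)" using l n0 by (metis power_minus_mult mult.commute)
    have "pow_map n \<circ> L = L \<circ> ?M \<circ> pow_map n"
    proof
      fix w show "(pow_map n \<circ> L) w = (L \<circ> ?M \<circ> pow_map n) w"
      proof (cases w)
        case None
        then show ?thesis using Ms L P by (simp add: o_def)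
      next
        case (Some z)
        have "(L \<circ> ?M \<circ> pow_map n) w = L (?M (Some (z ^ n)))" using Some P by simp
        also have "\<dots> = Some (l ^ n * z ^ n)" unfolding Ms L ln by (simp add: mult.assoc)
        finally show ?thesis using Some L P by (simp add: power_mult_distrib)
      qed
    qed
    then show ?thesis using moebius_conjugateI[OF M L(1)] by blast
  next
    case False
    have "?M None \<in> {Some 0, None}" using pres by auto
    then have a: "a = 0" using False unfolding f ev by auto
    then have b: "b \<noteq> 0" using D by auto
    have "?M (Some 0) \<in> {Some 0, None}" using pres by auto
    then have d: "d = 0" using b unfolding f ev by (auto split: if_splits)
    have Ms: "?M None = Some 0" "?M (Some z) = (if z = 0 then None else Some (b / c / z))" for z
      using False a b d unfolding f ev by simp_all
    \<comment> \<open>The condition is now l^(-n) = l (b / c), hence the exponent n + 1.\<close>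
    obtain l where l: "l ^ (n + 1) = c / b" using complex_root_exists[of "n + 1" "c / b"] by auto
    have l0: "l \<noteq> 0" using l b False by auto
    obtain L where L: "L \<in> moebius" "L None = None" "\<And>z. L (Some z) = Some (l * z)"
      using moebius_scaling[OF l0] by metis
    have ln: "1 / l ^ n = l * (b / c)" using l l0 b False by (simp add: field_simps)
    have "neg_pow_map n \<circ> L = L \<circ> ?M \<circ> pow_map n"
    proof
      fix w show "(neg_pow_map n \<circ> L) w = (L \<circ> ?M \<circ> pow_map n) w"
      proof (cases w)
        case None
        have "(L \<circ> ?M \<circ> pow_map n) w = L (?M None)" using None P by simp
        also have "\<dots> = Some 0" unfolding Ms L by simp
        finally show ?thesis using None L P by simp
      next
        case (Some z)
        have "(L \<circ> ?M \<circ> pow_map n) w = L (?M (Some (z ^ n)))" using Some P by simp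
        also have "\<dots> = (if z = 0 then None else Some (1 / l ^ n * (1 / z ^ n)))"
          unfolding Ms ln using L n0 by simp
        finally show ?thesis using Some L P l0 by (simp add: power_mult_distrib)
      qed
    qed
    then show ?thesis using moebius_conjugateI[OF M L(1)] by blast
  qed
qed

text \<open>\<open>\<sigma>\<close> carries the fibre through x bijectively onto the fibre through
  its image.\<close>

lemma deficient_semiconj:
  assumes "bij \<sigma>" "inj \<nu>" "R \<circ> \<sigma> = \<nu> \<circ> R"
  shows "\<sigma> x \<in> deficient n R \<longleftrightarrow> x \<in> deficient n R"
proof -
  have Rs: "R (\<sigma> y) = \<nu> (R y)" for y using fun_cong[OF assms(3), of y] by simp
  have "R -` {R (\<sigma> x)} = \<sigma> ` (R -` {R x})"
  proof (intro equalityI subsetI)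
    fix y assume y: "y \<in> R -` {R (\<sigma> x)}"
    obtain z where z: "y = \<sigma> z" using assms(1) by (metis bij_pointE)
    then show "y \<in> \<sigma> ` (R -` {R x})" using y assms(2) by (auto simp: Rs inj_eq)
  qed (auto simp: Rs)
  moreover have "inj_on \<sigma> A" for A using assms(1) bij_is_inj inj_on_subset by blast
  ultimately show ?thesis by (simp add: deficient_def card_image)
qed

lemma gamma_props:
  assumes "rational_of_degree n R" "n \<ge> 1" "\<sigma> \<in> carrier (symmetry_group R)"
  shows "gamma R \<sigma> \<in> moebius" "R \<circ> \<sigma> = gamma R \<sigma> \<circ> R"
proof -
  have "\<exists>!\<nu>. \<nu> \<in> moebius \<and> R \<circ> \<sigma> = \<nu> \<circ> R"
    using assms(3) moebius_factor_unique[OF assms(1,2)] unfolding symmetry_group_def by fastforce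
  then have "gamma R \<sigma> \<in> moebius \<and> R \<circ> \<sigma> = gamma R \<sigma> \<circ> R"
    unfolding gamma_def by (rule theI')
  then show "gamma R \<sigma> \<in> moebius" "R \<circ> \<sigma> = gamma R \<sigma> \<circ> R" by auto
qed

lemma finite_symmetry_subgroup:
  assumes R: "rational_of_degree n R" and n: "n \<ge> 2"
    and nc: "\<not> moebius_conjugate R (pow_map n)" "\<not> moebius_conjugate R (neg_pow_map n)"
    and G: "\<Gamma> \<subseteq> carrier (symmetry_group R)" and gG: "gamma R ` \<Gamma> \<subseteq> \<Gamma>"
  shows "finite \<Gamma>"
proof -
  define E where "E = deficient n R"
  have n1: "n \<ge> 1" using n by simp
  have finE: "finite E" using rational_finite_deficient[OF R n] by (simp add: E_def)
  have mob: "\<sigma> \<in> moebius" if "\<sigma> \<in> \<Gamma>" for \<sigma> using that G by (auto simp: symmetry_group_def)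
  have gam: "gamma R \<sigma> \<in> moebius" "R \<circ> \<sigma> = gamma R \<sigma> \<circ> R" if "\<sigma> \<in> \<Gamma>" for \<sigma>
    using gamma_props[OF R n1] that G by blast+
  have presE: "\<sigma> x \<in> E" if "\<sigma> \<in> \<Gamma>" "x \<in> E" for \<sigma> x
    using deficient_semiconj[OF moebius_bij[OF mob] bij_is_inj[OF moebius_bij[OF gam(1)]] gam(2)] that
    by (simp add: E_def)
  have presV: "gamma R \<sigma> w \<in> R ` E" if "\<sigma> \<in> \<Gamma>" "w \<in> R ` E" for \<sigma> w
  proof -
    obtain x where x: "x \<in> E" "w = R x" using \<open>w \<in> R ` E\<close> by auto
    have "gamma R \<sigma> w = R (\<sigma> x)" using fun_cong[OF gam(2)[OF that(1)], of x] x by simp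
    then show ?thesis using presE that x by auto
  qed
  let ?A = "E \<union> R ` E"
  \<comment> \<open>On R(E) this is the semiconjugacy; on E it holds because
    \<open>gamma R \<sigma>\<close> is itself an element of \<open>\<Gamma>\<close>. Uniting the two
    sets uses both actions.\<close>
  have pres: "gamma R \<sigma> x \<in> ?A" if "\<sigma> \<in> \<Gamma>" "x \<in> ?A" for \<sigma> x
    using that presV presE gG by blast
  show ?thesis
  proof (cases "card ?A \<ge> 3")
    case True
    have "finite {\<sigma> \<in> moebius. \<forall>x\<in>?A. \<sigma> x \<in> ?A}"
      using finite_moebius_into[OF True, of ?A] finE by blast
    moreover have "gamma R ` \<Gamma> \<subseteq> {\<sigma> \<in> moebius. \<forall>x\<in>?A. \<sigma> x \<in> ?A}"
      using gam(1) pres by blast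
    ultimately have finG: "finite (gamma R ` \<Gamma>)" by (rule finite_subset[rotated])
    \<comment> \<open>The relation R(\<sigma> x) = \<nu>(R x) confines \<sigma> x to a finite fibre
      for each of three test points.\<close>
    have "finite {\<sigma> \<in> \<Gamma>. gamma R \<sigma> = \<nu>}" for \<nu>
    proof -
      let ?B = "{Some 0, Some 1, None :: riemann_sphere}"
      have "finite {\<sigma> \<in> moebius. \<forall>x\<in>?B. \<sigma> x \<in> (\<Union>x\<in>?B. R -` {\<nu> (R x)})}"
        using rational_finite_fibre[OF R n] by (intro finite_moebius_into) auto
      moreover have "{\<sigma> \<in> \<Gamma>. gamma R \<sigma> = \<nu>}
          \<subseteq> {\<sigma> \<in> moebius. \<forall>x\<in>?B. \<sigma> x \<in> (\<Union>x\<in>?B. R -` {\<nu> (R x)})}"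
      proof
        fix \<sigma> assume s: "\<sigma> \<in> {\<sigma> \<in> \<Gamma>. gamma R \<sigma> = \<nu>}"
        then have "R (\<sigma> x) = \<nu> (R x)" for x using fun_cong[OF gam(2), of \<sigma> x] by simp
        then show "\<sigma> \<in> {\<sigma> \<in> moebius. \<forall>x\<in>?B. \<sigma> x \<in> (\<Union>x\<in>?B. R -` {\<nu> (R x)})}"
          using s mob by auto
      qed
      ultimately show ?thesis by (rule finite_subset[rotated])
    qed
    then have "finite (\<Union>\<nu>\<in>gamma R ` \<Gamma>. {\<sigma> \<in> \<Gamma>. gamma R \<sigma> = \<nu>})" using finG by blast
    moreover have "\<Gamma> = (\<Union>\<nu>\<in>gamma R ` \<Gamma>. {\<sigma> \<in> \<Gamma>. gamma R \<sigma> = \<nu>})" by auto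
    ultimately show ?thesis by simp
  next
    case False
    then have A2: "card ?A \<le> 2" by simp
    have "card E \<le> card ?A" using finE by (intro card_mono) auto
    then obtain M1 M2 where M: "M1 \<in> moebius" "M2 \<in> moebius" "R = M1 \<circ> pow_map n \<circ> M2"
      using rational_two_ramified_points[OF R n] A2 unfolding E_def by auto
    have n0: "n > 0" using n by simp
    note P = pow_map_simps[OF n0]
    have b1: "bij M1" and b2: "bij M2" using M moebius_bij by auto
    \<comment> \<open>\<open>y (Some 0)\<close> and \<open>y None\<close> are each alone in their
      fibre, so they lie in \<open>E\<close> and already exhaust \<open>?A\<close>. Hence R maps
      this pair into itself.\<close>
    define y where "y v = inv_into UNIV M2 v" for v
    have M2y: "M2 (y v) = v" for v using b2 by (simp add: y_def bij_is_surj surj_f_inv_f)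
    have yE: "y v \<in> E" if v: "v \<in> {Some 0, None}" for v
    proof -
      have "pow_map n u = pow_map n v \<longleftrightarrow> u = v" for u
        using v n0 by (cases u) (auto simp: P zero_power)
      then have "R -` {R (y v)} = {y v}"
        using inj_eq[OF bij_is_inj[OF b1]] inj_eq[OF bij_is_inj[OF b2], of _ "y v"] unfolding M(3)
        by (simp add: vimage_def M2y)
      then show ?thesis using n by (simp add: E_def deficient_def)
    qed
    have ne: "y (Some 0) \<noteq> y None" using M2y by (metis option.distinct(1))
    have "{y (Some 0), y None} = ?A"
    proof (rule card_seteq)
      show "card ?A \<le> card {y (Some 0), y None}" using A2 ne by simp
    qed (use finE yE in auto)
    then have in_A: "R (y v) \<in> {y (Some 0), y None}" if "v \<in> {Some 0, None}" for v
      using yE[OF that] by blast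
    \<comment> \<open>Since \<open>pow_map n\<close> fixes 0 and infinity, R (y v) = M1 v;
      invariance of the pair under R thus becomes invariance of {0, infinity} under
      \<open>M2 \<circ> M1\<close>.\<close>
    have "(M2 \<circ> M1) ` {Some 0, None} \<subseteq> {Some 0, None}"
    proof
      fix u assume "u \<in> (M2 \<circ> M1) ` {Some 0, None}"
      then obtain v where v: "v \<in> {Some 0, None}" "u = M2 (M1 v)" by auto
      have "pow_map n v = v" using v n0 by (auto simp: P)
      then have "R (y v) = M1 v" by (simp add: M(3) M2y)
      then have "M1 v \<in> {y (Some 0), y None}" using in_A[OF v(1)] by simp
      then show "u \<in> {Some 0, None}" using v(2) M2y by auto
    qed
    then show ?thesis using power_conjugate[OF n M(1,2)] nc M(3) by blast
  qed
qed

text \<open>Off the finite deficient set every fibre has at least n points.\<close>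

lemma rational_not_inj:
  assumes "rational_of_degree n R" "n \<ge> 2"
  shows "\<not> inj R"
proof -
  have "infinite (UNIV :: riemann_sphere set)" using infinite_UNIV_char_0 by (simp add: finite_option_UNIV)
  then obtain x where "x \<notin> deficient n R" using rational_finite_deficient[OF assms] by (meson UNIV_I subsetI finite_subset)
  then have "card (R -` {R x}) > 1" using assms(2) by (simp add: deficient_def)
  moreover have "R -` {R x} = {x}" if "inj R" using that by (auto simp: inj_eq)
  ultimately show ?thesis by auto
qed

section \<open>Normal forms in the semigroup\<close>

text \<open>Surjectivity of \<open>R\<close> gives right cancellation, and its failure to be
  injective separates the levels. Multiplicativity of \<open>g\<close> is implicit in the twist
  relation, because \<open>R\<close> can be cancelled on the right.\<close>

locale twisted_semigroup =
  fixes R :: "'a \<Rightarrow> 'a" and \<Gamma> :: "('a \<Rightarrow> 'a) set" and g :: "('a \<Rightarrow> 'a) \<Rightarrow> 'a \<Rightarrow> 'a"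
  assumes one: "id \<in> \<Gamma>"
    and comp: "\<sigma> \<in> \<Gamma> \<Longrightarrow> \<tau> \<in> \<Gamma> \<Longrightarrow> \<sigma> \<circ> \<tau> \<in> \<Gamma>"
    and inverse: "\<sigma> \<in> \<Gamma> \<Longrightarrow> \<exists>\<tau>\<in>\<Gamma>. \<sigma> \<circ> \<tau> = id \<and> \<tau> \<circ> \<sigma> = id"
    and surj_R: "surj R" and not_inj_R: "\<not> inj R"
    and twist: "\<sigma> \<in> \<Gamma> \<Longrightarrow> R \<circ> \<sigma> = g \<sigma> \<circ> R" and twist_in: "\<sigma> \<in> \<Gamma> \<Longrightarrow> g \<sigma> \<in> \<Gamma>"
begin

abbreviation "S \<equiv> generated_semigroup (\<circ>) (insert R \<Gamma>)"

lemma bij: "\<sigma> \<in> \<Gamma> \<Longrightarrow> bij \<sigma>"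
  using inverse o_bij by blast

lemma surj_funpow: "surj (R ^^ k)"
proof (induction k)
  case (Suc k)
  then show ?case unfolding funpow.simps(2) using surj_R by (rule comp_surj)
qed simp

lemma cancel_surj: "surj h \<Longrightarrow> a \<circ> h = b \<circ> h \<Longrightarrow> a = b"
  by (simp add: surj_fun_eq fun_eq_iff) (metis surjD)

lemma twist_funpow:
  assumes "\<sigma> \<in> \<Gamma>"
  shows "(g ^^ k) \<sigma> \<in> \<Gamma>" "R ^^ k \<circ> \<sigma> = (g ^^ k) \<sigma> \<circ> R ^^ k"
proof (induction k)
  case (Suc k)
  show "(g ^^ Suc k) \<sigma> \<in> \<Gamma>" using Suc twist_in by simp
  have "R ^^ Suc k \<circ> \<sigma> = R \<circ> (R ^^ k \<circ> \<sigma>)" by (simp add: comp_assoc)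
  also have "\<dots> = (R \<circ> (g ^^ k) \<sigma>) \<circ> R ^^ k" unfolding Suc(2) by (simp only: comp_assoc)
  also have "\<dots> = (g ^^ Suc k) \<sigma> \<circ> R ^^ Suc k" unfolding twist[OF Suc(1)] by (simp add: comp_assoc)
  finally show "R ^^ Suc k \<circ> \<sigma> = (g ^^ Suc k) \<sigma> \<circ> R ^^ Suc k" .
qed (use assms in auto)

lemma product_normal_form:
  "\<tau> \<in> \<Gamma> \<Longrightarrow> (\<sigma> \<circ> R ^^ k) \<circ> (\<tau> \<circ> R ^^ l) = (\<sigma> \<circ> (g ^^ k) \<tau>) \<circ> R ^^ (k + l)"
  using twist_funpow(2)[of \<tau> k] by (simp add: funpow_add fun_eq_iff)

lemma S_eq: "S = {\<sigma> \<circ> R ^^ k | \<sigma> k. \<sigma> \<in> \<Gamma>}"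
proof (intro equalityI subsetI)
  fix x assume "x \<in> S"
  then show "x \<in> {\<sigma> \<circ> R ^^ k | \<sigma> k. \<sigma> \<in> \<Gamma>}"
  proof induction
    case (generator a)
    then have "a = id \<circ> R ^^ 1 \<or> (a \<in> \<Gamma> \<and> a = a \<circ> R ^^ 0)" by auto
    then show ?case using one by blast
  next
    case (product a b)
    then obtain \<sigma> k \<tau> l where "a = \<sigma> \<circ> R ^^ k" "b = \<tau> \<circ> R ^^ l" "\<sigma> \<in> \<Gamma>" "\<tau> \<in> \<Gamma>" by blast
    then show ?case using product_normal_form comp twist_funpow(1) by blast
  qed
next
  fix x assume "x \<in> {\<sigma> \<circ> R ^^ k | \<sigma> k. \<sigma> \<in> \<Gamma>}"
  then obtain \<sigma> k where x: "x = \<sigma> \<circ> R ^^ k" "\<sigma> \<in> \<Gamma>" by blast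
  have "\<sigma> \<circ> R ^^ k \<in> S"
  proof (induction k)
    case 0
    then show ?case using x(2) by (simp add: generated_semigroup.generator)
  next
    case (Suc k)
    then have "(\<sigma> \<circ> R ^^ k) \<circ> R \<in> S"
      by (rule generated_semigroup.product) (simp add: generated_semigroup.generator)
    then show ?case by (simp only: funpow_Suc_right comp_assoc)
  qed
  then show "x \<in> S" using x by simp
qed

text \<open>For k < l, cancelling \<open>R ^^ k\<close> leaves the bijection \<open>\<sigma>\<close>
  with \<open>R\<close> as innermost factor, which would make \<open>R\<close> injective.\<close>

lemma normal_form_level:
  assumes "\<sigma> \<in> \<Gamma>" "\<tau> \<in> \<Gamma>" "\<sigma> \<circ> R ^^ k = \<tau> \<circ> R ^^ l" shows "k \<ge> l"
proof (rule ccontr)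
  assume "\<not> k \<ge> l"
  then obtain m where l: "l = Suc m + k" by (metis add.commute less_imp_Suc_add not_le add_Suc)
  have "\<sigma> \<circ> R ^^ k = (\<tau> \<circ> R ^^ Suc m) \<circ> R ^^ k" using assms(3) unfolding l by (simp only: funpow_add comp_assoc)
  then have "\<sigma> = \<tau> \<circ> R ^^ Suc m" by (rule cancel_surj[OF surj_funpow])
  then have "\<sigma> = (\<tau> \<circ> R ^^ m) \<circ> R" by (simp only: funpow_Suc_right comp_assoc)
  then have "inj R" using bij[OF assms(1)] by (metis bij_is_inj inj_on_imageI2)
  then show False using not_inj_R by simp
qed

lemma normal_form_unique:
  assumes "\<sigma> \<in> \<Gamma>" "\<tau> \<in> \<Gamma>" "\<sigma> \<circ> R ^^ k = \<tau> \<circ> R ^^ l"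
  shows "k = l" "\<sigma> = \<tau>"
proof -
  show kl: "k = l" using normal_form_level[OF assms] normal_form_level[OF assms(2,1) assms(3)[symmetric]] by simp
  show "\<sigma> = \<tau>" using cancel_surj[OF surj_funpow] assms(3) unfolding kl .
qed

definition level :: "('a \<Rightarrow> 'a) \<Rightarrow> nat" where
  "level x = (THE k. \<exists>\<sigma>\<in>\<Gamma>. x = \<sigma> \<circ> R ^^ k)"

lemma level_normal_form: "\<sigma> \<in> \<Gamma> \<Longrightarrow> level (\<sigma> \<circ> R ^^ k) = k"
  unfolding level_def by (rule the_equality) (use normal_form_unique in blast)+

lemma level_comp: "x \<in> S \<Longrightarrow> y \<in> S \<Longrightarrow> level (x \<circ> y) = level x + level y"
proof -
  assume "x \<in> S" "y \<in> S"
  then obtain \<sigma> k \<tau> l where "\<sigma> \<in> \<Gamma>" "x = \<sigma> \<circ> R ^^ k" "\<tau> \<in> \<Gamma>" "y = \<tau> \<circ> R ^^ l"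
    unfolding S_eq by blast
  then show ?thesis
    using comp twist_funpow(1) level_normal_form by (simp only: product_normal_form)
qed

lemma level_set: "{x \<in> S. level x = k} \<subseteq> (\<lambda>\<sigma>. \<sigma> \<circ> R ^^ k) ` \<Gamma>"
  unfolding S_eq using level_normal_form by auto

lemma right_cancel: "x \<in> S \<Longrightarrow> inj_on (\<lambda>y. y \<circ> x) T"
proof -
  assume "x \<in> S"
  then obtain \<sigma> k where "\<sigma> \<in> \<Gamma>" "x = \<sigma> \<circ> R ^^ k" unfolding S_eq by blast
  then have "surj x" using bij surj_funpow comp_surj bij_is_surj by metis
  then show ?thesis by (intro inj_onI) (rule cancel_surj)
qed

text \<open>Moving \<open>R ^^ k\<close> past \<open>\<tau>\<close> turns it into
  \<open>(g ^^ k) \<tau>\<close>. The normal form recovers that element, and injectivity of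
  \<open>g\<close> undoes the k steps.\<close>

lemma left_cancel:
  assumes "inj_on g \<Gamma>" "x \<in> S" shows "inj_on ((\<circ>) x) S"
proof (rule inj_onI)
  fix y z assume "y \<in> S" "z \<in> S" and eq: "x \<circ> y = x \<circ> z"
  then obtain \<sigma> k \<tau> l \<rho> m where x: "\<sigma> \<in> \<Gamma>" "x = \<sigma> \<circ> R ^^ k" and y: "\<tau> \<in> \<Gamma>" "y = \<tau> \<circ> R ^^ l"
    and z: "\<rho> \<in> \<Gamma>" "z = \<rho> \<circ> R ^^ m" using assms(2) unfolding S_eq by blast
  have "(\<sigma> \<circ> (g ^^ k) \<tau>) \<circ> R ^^ (k + l) = (\<sigma> \<circ> (g ^^ k) \<rho>) \<circ> R ^^ (k + m)"
    using eq product_normal_form x y z by metis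
  then have "l = m" and e: "\<sigma> \<circ> (g ^^ k) \<tau> = \<sigma> \<circ> (g ^^ k) \<rho>"
    using normal_form_unique[of "\<sigma> \<circ> (g ^^ k) \<tau>" "\<sigma> \<circ> (g ^^ k) \<rho>" "k + l" "k + m"]
      x y z comp twist_funpow(1) by auto
  have "(g ^^ k) \<tau> = (g ^^ k) \<rho>"
    using e bij[OF x(1)] by (metis bij_is_inj fun.inj_map inj_eq)
  moreover have "(g ^^ j) \<tau> = (g ^^ j) \<rho> \<Longrightarrow> \<tau> = \<rho>" for j
    by (induction j) (use assms(1) y z twist_funpow(1) in \<open>auto simp: inj_on_eq_iff\<close>)
  ultimately show "y = z" using y z \<open>l = m\<close> by blast
qed

text \<open>Allowing both orders of composition lets one Foelner argument serve both kinds of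
  amenability. The grading is symmetric; only the injectivity hypothesis depends on the
  side.\<close>

lemma subsemigroup_left_amenable:
  fixes f :: "('a \<Rightarrow> 'a) \<Rightarrow> ('a \<Rightarrow> 'a) \<Rightarrow> 'a \<Rightarrow> 'a"
  assumes "finite \<Gamma>" and T: "subsemigroup (\<circ>) T S"
    and f: "f = (\<circ>) \<or> f = (\<lambda>x y. y \<circ> x)" and inj: "\<And>a. a \<in> T \<Longrightarrow> inj_on (f a) T"
  shows "left_amenable f T"
proof (rule left_amenable_graded[where lev = level and M = "card \<Gamma>"])
  have TS: "T \<subseteq> S" and cl: "a \<in> T \<Longrightarrow> b \<in> T \<Longrightarrow> a \<circ> b \<in> T" and ne: "T \<noteq> {}" for a b
    using T by (auto simp: subsemigroup_def)
  show "T \<noteq> {}" by (rule ne)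
  show "f a b \<in> T" if "a \<in> T" "b \<in> T" for a b using f cl that by auto
  show "level (f a b) = level a + level b" if "a \<in> T" "b \<in> T" for a b
  proof -
    have "a \<in> S" "b \<in> S" using that TS by auto
    then show ?thesis using f level_comp by auto
  qed
  have sub: "{t \<in> T. level t = k} \<subseteq> (\<lambda>\<sigma>. \<sigma> \<circ> R ^^ k) ` \<Gamma>" for k using TS level_set[of k] by blast
  show "finite {t \<in> T. level t = k}" for k
    using sub assms(1) by (meson finite_imageI finite_subset)
  show "card {t \<in> T. level t = k} \<le> card \<Gamma>" for k
    using card_mono[OF _ sub] card_image_le assms(1) order_trans finite_imageI by meson
qed (rule inj)

lemma subsemigroup_right_amenable:
  assumes "finite \<Gamma>" "subsemigroup (\<circ>) T S"
  shows "right_amenable (\<circ>) T"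
  unfolding right_amenable_flip
proof (rule subsemigroup_left_amenable[OF assms])
  show "inj_on (\<lambda>y. y \<circ> a) T" if "a \<in> T" for a
    using right_cancel that assms(2) by (auto simp: subsemigroup_def)
qed simp

lemma subsemigroup_amenable:
  assumes "finite \<Gamma>" "g ` \<Gamma> = \<Gamma>" "subsemigroup (\<circ>) T S"
  shows "amenable (\<circ>) T"
proof -
  have "inj_on g \<Gamma>" using assms(1,2) by (simp add: finite_surj_inj endo_inj_surj eq_card_imp_inj_on)
  then have "inj_on ((\<circ>) a) T" if "a \<in> T" for a
    using left_cancel that assms(3) inj_on_subset unfolding subsemigroup_def by blast
  then have "left_amenable (\<circ>) T" by (intro subsemigroup_left_amenable[OF assms(1,3)]) auto
  then show ?thesis using subsemigroup_right_amenable assms by (simp add: amenable_def)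
qed

text \<open>
  For \<tau> outside the image of g the right ideals R S and \<tau> R S are disjoint, while a
  left-invariant measure gives full measure to both.
\<close>

lemma left_amenable_imp_surj:
  assumes "left_amenable (\<circ>) S"
  shows "\<Gamma> \<subseteq> g ` \<Gamma>"
proof
  fix \<tau> assume t: "\<tau> \<in> \<Gamma>"
  obtain \<mu> where \<mu>: "finitely_additive_probability S \<mu>"
    and inv: "\<And>a T. a \<in> S \<Longrightarrow> T \<subseteq> S \<Longrightarrow> \<mu> {s \<in> S. a \<circ> s \<in> T} = \<mu> T"
    using assms unfolding left_amenable_def by blast
  have nonneg: "T \<subseteq> S \<Longrightarrow> 0 \<le> \<mu> T" and one': "\<mu> S = 1"
    and add: "A \<subseteq> S \<Longrightarrow> B \<subseteq> S \<Longrightarrow> A \<inter> B = {} \<Longrightarrow> \<mu> (A \<union> B) = \<mu> A + \<mu> B" for T A B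
    using \<mu> unfolding finitely_additive_probability_def Measure_Space.additive_def by auto
  have gen: "R \<in> S" "\<tau> \<in> S" using t by (auto intro: generated_semigroup.generator)
  then have tR: "\<tau> \<circ> R \<in> S" using generated_semigroup.product by metis
  have ideal: "(\<circ>) a ` S \<subseteq> S" "\<mu> ((\<circ>) a ` S) = 1" if a: "a \<in> S" for a
  proof -
    show sub: "(\<circ>) a ` S \<subseteq> S" using a by (auto intro: generated_semigroup.product)
    have "{s \<in> S. a \<circ> s \<in> (\<circ>) a ` S} = S" by auto
    then show "\<mu> ((\<circ>) a ` S) = 1" using inv[OF a sub] one' by simp
  qed
  have "(\<circ>) R ` S \<inter> (\<circ>) (\<tau> \<circ> R) ` S \<noteq> {}"
  proof
    let ?U = "(\<circ>) R ` S \<union> (\<circ>) (\<tau> \<circ> R) ` S"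
    assume "(\<circ>) R ` S \<inter> (\<circ>) (\<tau> \<circ> R) ` S = {}"
    then have "\<mu> ?U = 2" using add ideal gen tR by simp
    moreover have US: "?U \<subseteq> S" using ideal gen tR by blast
    moreover have "\<mu> S = \<mu> ?U + \<mu> (S - ?U)"
    proof -
      have "S = ?U \<union> (S - ?U)" using US by blast
      then show ?thesis using add[of ?U "S - ?U"] US by (metis Diff_disjoint Diff_subset)
    qed
    ultimately show False using nonneg[of "S - ?U"] one' by simp
  qed
  then obtain s s' where s: "s \<in> S" "s' \<in> S" "R \<circ> s = \<tau> \<circ> R \<circ> s'" by blast
  then obtain \<sigma> k \<rho> l where sig: "\<sigma> \<in> \<Gamma>" "s = \<sigma> \<circ> R ^^ k" and rho: "\<rho> \<in> \<Gamma>" "s' = \<rho> \<circ> R ^^ l"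
    unfolding S_eq by blast
  have "g \<sigma> \<circ> R ^^ Suc k = (\<tau> \<circ> g \<rho>) \<circ> R ^^ Suc l"
  proof -
    have "g \<sigma> \<circ> R ^^ Suc k = (R \<circ> \<sigma>) \<circ> R ^^ k" unfolding twist[OF sig(1)] by (simp add: comp_assoc)
    also have "\<dots> = \<tau> \<circ> (R \<circ> \<rho>) \<circ> R ^^ l" using s(3) sig(2) rho(2) by (simp add: comp_assoc)
    also have "\<dots> = (\<tau> \<circ> g \<rho>) \<circ> R ^^ Suc l" unfolding twist[OF rho(1)] by (simp add: comp_assoc)
    finally show ?thesis .
  qed
  \<comment> \<open>Comparing the normal forms of a common element of the two ideals exhibits
    \<open>\<tau>\<close> as the image of \<open>\<sigma>\<close> composed with the inverse of
    \<open>\<rho>\<close>.\<close>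
  then have e: "g \<sigma> = \<tau> \<circ> g \<rho>"
    using normal_form_unique(2) twist_in sig(1) rho(1) t comp by metis
  obtain \<rho>' where r: "\<rho>' \<in> \<Gamma>" "\<rho> \<circ> \<rho>' = id" using inverse[OF rho(1)] by blast
  have sr: "\<sigma> \<circ> \<rho>' \<in> \<Gamma>" using comp sig(1) r(1) by blast
  have "g (\<sigma> \<circ> \<rho>') \<circ> R = R \<circ> \<sigma> \<circ> \<rho>'" using twist[OF sr] by (simp add: comp_assoc)
  also have "\<dots> = \<tau> \<circ> (R \<circ> \<rho>) \<circ> \<rho>'" unfolding twist[OF sig(1)] twist[OF rho(1)] e by (simp add: comp_assoc)
  also have "\<dots> = \<tau> \<circ> R" using r(2) by (simp add: comp_assoc)
  finally have "g (\<sigma> \<circ> \<rho>') = \<tau>" by (rule cancel_surj[OF surj_R])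
  then show "\<tau> \<in> g ` \<Gamma>" using sr by blast
qed

end

theorem theorem1p4:
  fixes R :: "riemann_sphere \<Rightarrow> riemann_sphere"
    and n :: nat
    and \<Gamma> S :: "(riemann_sphere \<Rightarrow> riemann_sphere) set"
  assumes "rational_of_degree n R" and "n \<ge> 2"
    and "\<not> moebius_conjugate R (pow_map n)"
    and "\<not> moebius_conjugate R (neg_pow_map n)"
    and "subgroup \<Gamma> (symmetry_group R)"
    and "gamma R ` \<Gamma> \<subseteq> \<Gamma>"
  defines "S \<equiv> generated_semigroup (\<circ>) (insert R \<Gamma>)"
  shows "(\<forall>T. subsemigroup (\<circ>) T S \<longrightarrow> right_amenable (\<circ>) T)
    \<and> (left_amenable (\<circ>) S \<longleftrightarrow> gamma R ` \<Gamma> = \<Gamma>)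
    \<and> (gamma R ` \<Gamma> = \<Gamma> \<longrightarrow> (\<forall>T. subsemigroup (\<circ>) T S \<longrightarrow> amenable (\<circ>) T))"
proof -
  interpret G: group "symmetry_group R" by (rule group_symmetry_group)
  interpret H: subgroup \<Gamma> "symmetry_group R" by fact
  have ops: "x \<otimes>\<^bsub>symmetry_group R\<^esub> y = x \<circ> y" "\<one>\<^bsub>symmetry_group R\<^esub> = id" for x y
    by (simp_all add: symmetry_group_def)
  have n1: "n \<ge> 1" using assms(2) by simp
  interpret twisted_semigroup R \<Gamma> "gamma R"
  proof
    show "id \<in> \<Gamma>" using H.one_closed by (simp add: ops)
    show "\<sigma> \<circ> \<tau> \<in> \<Gamma>" if "\<sigma> \<in> \<Gamma>" "\<tau> \<in> \<Gamma>" for \<sigma> \<tau> using H.m_closed[OF that] by (simp add: ops)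
    show "\<exists>\<tau>\<in>\<Gamma>. \<sigma> \<circ> \<tau> = id \<and> \<tau> \<circ> \<sigma> = id" if "\<sigma> \<in> \<Gamma>" for \<sigma>
      using H.m_inv_closed[OF that] G.l_inv[OF H.mem_carrier[OF that]] G.r_inv[OF H.mem_carrier[OF that]]
      by (auto simp: ops)
    show "surj R"
      using assms(1,2) surj_rat_map unfolding rational_of_degree_def by auto
    show "\<not> inj R" using assms(1,2) by (rule rational_not_inj)
    show "R \<circ> \<sigma> = gamma R \<sigma> \<circ> R" if "\<sigma> \<in> \<Gamma>" for \<sigma>
      using gamma_props(2)[OF assms(1) n1 H.mem_carrier[OF that]] .
    show "gamma R \<sigma> \<in> \<Gamma>" if "\<sigma> \<in> \<Gamma>" for \<sigma> using assms(6) that by auto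
  qed
  have fin: "finite \<Gamma>"
    using finite_symmetry_subgroup[OF assms(1-4) H.subset assms(6)] .
  \<comment> \<open>Left amenability of \<open>S\<close> itself is the case T = S of the statement
    on subsemigroups.\<close>
  have "subsemigroup (\<circ>) S S"
    unfolding subsemigroup_def S_def
    by (auto intro: generated_semigroup.intros)
  then show ?thesis
    using subsemigroup_right_amenable[OF fin] subsemigroup_amenable[OF fin] left_amenable_imp_surj assms(6)
    unfolding S_def amenable_def by blast
qed

end
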